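(* Fix a web CA rule $f$ that is either diagonal-compliant or wide-compliant, and for each $L\ge0$ start the CA from a uniformly random binary seed $\xi_0$ on $[0,L]$. There exist $R_L\in[0,\infty]$ and ethers $\eta_L$, both deterministic functions of the seed, having the following basic properties: $\mathbf P(R_L=\infty)\to0$ as $L\to\infty$ and $(R_L)_{L\ge 0}$ is tight; on the event $R_L<\infty$, $\xi$ is a replicator of thickness $R_L+L$ and ether $\eta_L$; and if any finite set of $0$s in $\xi_0$ are changed into $2$s, the resulting configuration is still (on $R_L<\infty$) a replicator of thickness $R_L+L$ and ether $\eta_L$ with the same $R_L,\eta_L$. Moreover, these can be chosen to have the following additional properties: (i) If the CA rule has no spontaneous birth, then $\eta_L\equiv 0$ whenever $R_L<\infty$. (ii) Suppose that the CA rule has spontaneous birth. If for some deterministic ether $\eta$ we have $R_{L}<\infty$ and $\eta_{L}=\eta$ for some binary seed (on some interval $[0,L]$), then for uniformly random binary seeds on $[0,L]$ we have $$\liminf_{L\to\infty}\mathbf P(R_L<\infty\text{ and }\eta_L=\eta)>0.$$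
   Context: All intervals are subsets of $\mathbb Z$. A (3-state, range-2) cellular automaton (CA) rule is a function $f:\{0,1,2\}^5\to\{0,1,2\}$; from $\xi_0\in\{0,1,2\}^{\mathbb Z}$ it evolves by $\xi_{t+1}(x)=f(\xi_t(x-2),\xi_t(x-1),\xi_t(x),\xi_t(x+1),\xi_t(x+2))$, $t=0,1,2,\dots$. Write $\xi(x,t)=\xi_t(x)$. A seed is an initial configuration with finite support; it is binary if it has values in $\{0,1\}$. Let $\delta(a)=\mathbf 1[a=1]$. The rule $f$ is a web CA if $f(0,0,0,0,0)=0$ and $\delta(f(a,b,c,d,e))=\delta(b)+\delta(c)+\delta(d) \bmod 2$ for all $a,b,c,d,e\in\{0,1,2\}$. Below $a,\dots,e,a',\dots,e'\in\{0,1,2\}$ are arbitrary subject to $\delta(a)=\delta(a'),\dots,\delta(e)=\delta(e')$; put $\ell=\delta(a)+\delta(b)+\delta(c)\bmod 2$ and $r=\delta(c)+\delta(d)+\delta(e)\bmod 2$. - $f$ is empty-compliant if always $f(a,b,c,d,e)=f(a',b,c,d,e')$. - $f$ is diagonal-compliant if always $f(a,b,c,d,e)=f(a',b,c',d,e')$. - $f$ is wide-compliant if it is empty-compliant and: $c=r=1$ implies $f(a,b,c,d,e)=f(a',b,c,d',e')$; and $c=\ell=1$ implies $f(a,b,c,d,e)=f(a',b',c,d,e')$. The rule has no spontaneous birth if whenever $\xi_0$ contains no $2$s, $\xi_1$ also contains no $2$s; otherwise it has spontaneous birth. A uniformly random binary seed on $[0,L]$ is a $\xi_0$ where $\xi_0(x)$,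 $x\in[0,L]$, are independent taking values $0,1$ with probability $1/2$ each, and $\xi_0(x)=0$ for $x\notin[0,L]$. The 1 Or 3 CA is the binary CA $\lambda_{t+1}(x)=\lambda_t(x-1)+\lambda_t(x)+\lambda_t(x+1)\bmod 2$. Let $\lambda^\bullet$ be this CA started from a single $1$ at the origin, $\Lambda=\{(x,t):\lambda^\bullet(x,t)=1\}$, and let $\Lambda(r)\subset\mathbb Z^2$ be the set of points at $\ell^1$-distance at most $r$ from $\Lambda$. An ether is an element $\eta\in\{0,2\}^{\mathbb Z^2}$ that is periodic in both coordinates. Two ethers are equivalent if one is a translate of the other by an element of $\mathbb Z^2$. A set $K\subseteq\mathbb Z\times[0,\infty)$ is filled with $\eta$ (in a configuration $\xi$) if $\xi$ agrees on $K$ with some ether equivalent to $\eta$. A configuration $\xi$ is a replicator of thickness $r$ and ether $\eta$ if each bounded connected component of $\mathbb Z^2\setminus\Lambda(r)$ (nearest-neighbour adjacency) is filled with $\eta$. Tightness of $(R_L)$ means $\lim_{\rho\to\infty}\limsup_{L\to\infty}\mathbf P(R_L>\rho)=0$. *)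

theory Defs
  imports "HOL-Probability.Probability" "HOL-Probability.Product_PMF"
begin

section \<open>Range-2 cellular automata with three states\<close>

text \<open>The constructors \<open>S0\<close>, \<open>S1\<close>, \<open>S2\<close> stand for the states 0, 1, 2.\<close>

datatype state = S0 | S1 | S2

type_synonym rule = "state \<Rightarrow> state \<Rightarrow> state \<Rightarrow> state \<Rightarrow> state \<Rightarrow> state"

text \<open>\<open>evolve f \<xi>0 t x\<close> is $\xi(x,t) = \xi_t(x)$; note the order of the arguments.\<close>

primrec evolve :: "rule \<Rightarrow> (int \<Rightarrow> state) \<Rightarrow> nat \<Rightarrow> int \<Rightarrow> state" where
  "evolve f \<xi>0 0 = \<xi>0"
| "evolve f \<xi>0 (Suc t) =
     (\<lambda>x. f (evolve f \<xi>0 t (x - 2)) (evolve f \<xi>0 t (x - 1)) (evolve f \<xi>0 t x)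
            (evolve f \<xi>0 t (x + 1)) (evolve f \<xi>0 t (x + 2)))"

definition \<delta> :: "state \<Rightarrow> nat" where
  "\<delta> a = (if a = S1 then 1 else 0)"

definition web_CA :: "rule \<Rightarrow> bool" where
  "web_CA f \<longleftrightarrow> f S0 S0 S0 S0 S0 = S0 \<and>
     (\<forall>a b c d e. \<delta> (f a b c d e) = (\<delta> b + \<delta> c + \<delta> d) mod 2)"

definition empty_compliant :: "rule \<Rightarrow> bool" where
  "empty_compliant f \<longleftrightarrow>
     (\<forall>a b c d e a' e'. \<delta> a = \<delta> a' \<longrightarrow> \<delta> e = \<delta> e' \<longrightarrow>
        f a b c d e = f a' b c d e')"

definition diagonal_compliant :: "rule \<Rightarrow> bool" where
  "diagonal_compliant f \<longleftrightarrow>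
     (\<forall>a b c d e a' c' e'. \<delta> a = \<delta> a' \<longrightarrow> \<delta> c = \<delta> c' \<longrightarrow> \<delta> e = \<delta> e' \<longrightarrow>
        f a b c d e = f a' b c' d e')"

definition wide_compliant :: "rule \<Rightarrow> bool" where
  "wide_compliant f \<longleftrightarrow> empty_compliant f \<and>
     (\<forall>a b c d e a' d' e'. \<delta> a = \<delta> a' \<longrightarrow> \<delta> d = \<delta> d' \<longrightarrow> \<delta> e = \<delta> e' \<longrightarrow>
        c = S1 \<and> (\<delta> c + \<delta> d + \<delta> e) mod 2 = 1 \<longrightarrow>
        f a b c d e = f a' b c d' e') \<and>
     (\<forall>a b c d e a' b' e'. \<delta> a = \<delta> a' \<longrightarrow> \<delta> b = \<delta> b' \<longrightarrow> \<delta> e = \<delta> e' \<longrightarrow>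
        c = S1 \<and> (\<delta> a + \<delta> b + \<delta> c) mod 2 = 1 \<longrightarrow>
        f a b c d e = f a' b' c d e')"

definition spontaneous_birth :: "rule \<Rightarrow> bool" where
  "spontaneous_birth f \<longleftrightarrow>
     \<not> (\<forall>\<xi>0. (\<forall>x. \<xi>0 x \<noteq> S2) \<longrightarrow> (\<forall>x. evolve f \<xi>0 1 x \<noteq> S2))"


section \<open>Random binary seeds\<close>

definition binary_seeds_on :: "nat \<Rightarrow> (int \<Rightarrow> state) set" where
  "binary_seeds_on L =
     {\<xi>0. (\<forall>x. \<xi>0 x \<in> {S0, S1}) \<and> (\<forall>x. x \<notin> {0..int L} \<longrightarrow> \<xi>0 x = S0)}"

text \<open>Independent fair values on \<open>{0..L}\<close>, and the default value \<open>S0\<close> elsewhere.\<close>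

definition random_seed :: "nat \<Rightarrow> (int \<Rightarrow> state) pmf" where
  "random_seed L = Pi_pmf {0..int L} S0 (\<lambda>_. pmf_of_set {S0, S1})"

definition change_to_2 :: "int set \<Rightarrow> (int \<Rightarrow> state) \<Rightarrow> int \<Rightarrow> state" where
  "change_to_2 A \<xi>0 = (\<lambda>x. if x \<in> A then S2 else \<xi>0 x)"


section \<open>The 1 Or 3 cellular automaton and its neighbourhoods in the lattice\<close>

primrec one_or_three :: "(int \<Rightarrow> nat) \<Rightarrow> nat \<Rightarrow> int \<Rightarrow> nat" where
  "one_or_three \<zeta>0 0 = \<zeta>0"
| "one_or_three \<zeta>0 (Suc t) =
     (\<lambda>x. (one_or_three \<zeta>0 t (x - 1) + one_or_three \<zeta>0 t x + one_or_three \<zeta>0 t (x + 1)) mod 2)"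

definition \<Lambda> :: "(int \<times> int) set" where
  "\<Lambda> = {(x, int t) | x t. one_or_three (\<lambda>y. if y = 0 then 1 else 0) t x = 1}"

definition l1_dist :: "int \<times> int \<Rightarrow> int \<times> int \<Rightarrow> int" where
  "l1_dist p q = \<bar>fst p - fst q\<bar> + \<bar>snd p - snd q\<bar>"

definition \<Lambda>_nbhd :: "real \<Rightarrow> (int \<times> int) set" where
  "\<Lambda>_nbhd r = {p. \<exists>q\<in>\<Lambda>. real_of_int (l1_dist p q) \<le> r}"

definition lattice_component :: "(int \<times> int) set \<Rightarrow> int \<times> int \<Rightarrow> (int \<times> int) set" where
  "lattice_component S p = {q. (p, q) \<in> {(u, v). u \<in> S \<and> v \<in> S \<and> l1_dist u v = 1}\<^sup>*}"

definition lattice_components :: "(int \<times> int) set \<Rightarrow> (int \<times> int) set set" where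
  "lattice_components S = lattice_component S ` S"


section \<open>Ethers and replicators\<close>

definition ether :: "(int \<times> int \<Rightarrow> state) \<Rightarrow> bool" where
  "ether \<eta> \<longleftrightarrow> (\<forall>p. \<eta> p \<in> {S0, S2}) \<and>
     (\<exists>m>0. \<forall>x t. \<eta> (x + m, t) = \<eta> (x, t)) \<and>
     (\<exists>n>0. \<forall>x t. \<eta> (x, t + n) = \<eta> (x, t))"

definition ether_equiv :: "(int \<times> int \<Rightarrow> state) \<Rightarrow> (int \<times> int \<Rightarrow> state) \<Rightarrow> bool" where
  "ether_equiv \<eta> \<eta>' \<longleftrightarrow> (\<exists>a b. \<forall>x t. \<eta>' (x, t) = \<eta> (x + a, t + b))"

text \<open>Being filled is only meaningful for sets of points with nonnegative time coordinate,
  hence the first conjunct.\<close>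

definition filled ::
  "(nat \<Rightarrow> int \<Rightarrow> state) \<Rightarrow> (int \<times> int \<Rightarrow> state) \<Rightarrow> (int \<times> int) set \<Rightarrow> bool" where
  "filled \<xi> \<eta> K \<longleftrightarrow> K \<subseteq> UNIV \<times> {0..} \<and>
     (\<exists>\<eta>'. ether \<eta>' \<and> ether_equiv \<eta> \<eta>' \<and> (\<forall>(x, t)\<in>K. \<xi> (nat t) x = \<eta>' (x, t)))"

text \<open>A subset of the lattice is bounded iff it is finite.\<close>

definition replicator ::
  "(nat \<Rightarrow> int \<Rightarrow> state) \<Rightarrow> real \<Rightarrow> (int \<times> int \<Rightarrow> state) \<Rightarrow> bool" where
  "replicator \<xi> r \<eta> \<longleftrightarrow>
     (\<forall>K \<in> lattice_components (- \<Lambda>_nbhd r). finite K \<longrightarrow> filled \<xi> \<eta> K)"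

end

theory Submission imports Defs "HOL-Library.Z2" begin

text \<open>The cells in state 1 form the additive 1 Or 3 web, so only the spread of the states 0 and 2
  through the holes of the web has to be understood. Every large void of the 1 Or 3 pattern has its top
  row at a multiple of \<open>N = 2 ^ k\<close>, and \<open>N\<close> steps earlier the web of a seed near that
  void is a translate of one fixed row, of period \<open>3 * N\<close>: the seed folded onto the pattern
  0, 1, 1 on the multiples of \<open>N\<close>. If that row determines the states \<open>N\<close> steps later
  no matter where its 2s are, then every large void starts from a translate of the same periodic row of
  0s and 2s. Inside the void information travels no faster than its sides close in, so the void evolves
  as if this row were bi-infinite; a periodic row is eventually periodic in time, and this is the ether.

  For a long random seed the folded row is uniformly distributed on the solutions \<open>w\<close> of
  \<open>w (x - N) + w x + w (x + N) = 0\<close>, and going back one step reveals two fresh bits. The expected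
  number of positions in a period whose state still matters is thereby multiplied by at most 7/8 in two
  steps (diagonal case) or, counting the edges that they touch, by 3/4 in one step (wide case), whereas
  the period is only linear in \<open>N\<close>. Hence the row fails to determine the future with a
  probability that tends to 0 as \<open>k\<close> grows.\<close>

declare add_bit_eq_xor [simp del] mult_bit_eq_and [simp del]

lemma bit_add_self [simp]: "a + a = (0 :: bit)" "a + (a + b) = (b :: bit)"
  by (cases a; simp)+

lemma bit_eq_if_add_zero: "a + b = 0 \<Longrightarrow> a = (b :: bit)"
  by (cases a; cases b) auto

section \<open>The 1 Or 3 rule over the field with two elements\<close>

definition one3 :: "(int \<Rightarrow> bit) \<Rightarrow> int \<Rightarrow> bit" where
  "one3 w x = w (x - 1) + w x + w (x + 1)"

text \<open>Frobenius in characteristic 2: in terms of the shift z, the rule is multiplication by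
  z^-1 + 1 + z, and squaring squares each term. In the induction the mixed terms cancel in
  pairs.\<close>

lemma one3_pow2: "(one3 ^^ (2 ^ k)) w x = w (x - 2 ^ k) + w x + w (x + 2 ^ k)"
proof (induction k arbitrary: w x)
  case 0
  show ?case by (simp add: one3_def)
next
  case (Suc k)
  have "(one3 ^^ (2 ^ Suc k)) w x = (one3 ^^ (2 ^ k)) ((one3 ^^ (2 ^ k)) w) x"
    by (simp add: funpow_add mult_2)
  also have "\<dots> = w (x - 2 ^ Suc k) + w x + w (x + 2 ^ Suc k)"
    unfolding Suc by (simp add: algebra_simps)
  finally show ?case .
qed

lemma one3_pow_add: "(one3 ^^ n) (\<lambda>x. v x + w x) = (\<lambda>x. (one3 ^^ n) v x + (one3 ^^ n) w x)"
proof (induction n)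
  case (Suc n)
  then show ?case by (auto simp: one3_def fun_eq_iff algebra_simps)
qed auto

lemma one3_pow_zero [simp]: "(one3 ^^ n) (\<lambda>_. 0) = (\<lambda>_. 0)"
  by (induction n) (auto simp: one3_def fun_eq_iff)

lemma one3_pow_shift: "(one3 ^^ n) (\<lambda>x. w (x - a)) = (\<lambda>x. (one3 ^^ n) w (x - a))"
  by (induction n) (auto simp: one3_def fun_eq_iff algebra_simps)

lemma one3_pow_scale: "(one3 ^^ n) (\<lambda>x. c * w x) = (\<lambda>x. c * (one3 ^^ n) w x)"
  by (cases c) auto

lemma one3_pow_sum:
  "finite A \<Longrightarrow> (one3 ^^ n) (\<lambda>x. \<Sum>i\<in>A. g i x) = (\<lambda>x. \<Sum>i\<in>A. (one3 ^^ n) (g i) x)"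
  by (induction A rule: finite_induct) (auto simp: one3_pow_add)

lemma one3_pow_local:
  assumes "\<And>x. p \<le> x \<Longrightarrow> x \<le> q \<Longrightarrow> v x = w x" "p + int n \<le> x" "x \<le> q - int n"
  shows "(one3 ^^ n) v x = (one3 ^^ n) w x"
  using assms(2,3)
proof (induction n arbitrary: x)
  case 0
  then show ?case using assms(1) by auto
next
  case (Suc n)
  then show ?case by (simp add: one3_def)
qed

lemma one3_pow_local_zero:
  assumes "\<And>x. p \<le> x \<Longrightarrow> x \<le> q \<Longrightarrow> v x = 0" "p + int n \<le> x" "x \<le> q - int n"
  shows "(one3 ^^ n) v x = 0"
  using one3_pow_local[of p q v "\<lambda>_. 0"] assms by simp

text \<open>The recurrence gives each outer value from the two others, so a window of
  \<open>2 * N\<close> zeros spreads to the right and to the left as far as the recurrence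
  holds.\<close>

lemma recurrence_zero:
  fixes d :: "int \<Rightarrow> bit"
  assumes rec: "\<And>x. p + N \<le> x \<Longrightarrow> x \<le> q - N \<Longrightarrow> d (x - N) + d x + d (x + N) = 0"
    and "N \<ge> 1" "p \<le> c" "c + 2 * N - 1 \<le> q"
    and win: "\<And>x. c \<le> x \<Longrightarrow> x < c + 2 * N \<Longrightarrow> d x = 0"
    and "p \<le> x" "x \<le> q"
  shows "d x = 0"
proof -
  have up: "c + int n \<le> q \<Longrightarrow> d (c + int n) = 0" for n
  proof (induction n rule: less_induct)
    case (less n)
    show ?case
    proof (cases "int n < 2 * N")
      case False
      \<comment> \<open>The positions one and two blocks of length \<open>N\<close> back; indices
        below \<open>2 * N\<close> lie in the window itself.\<close>
      define a b where "a = nat (int n - N)" and "b = nat (int n - 2 * N)"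
      have ab: "int a = int n - N" "int b = int n - 2 * N" "a < n" "b < n"
        using False \<open>N \<ge> 1\<close> by (auto simp: a_def b_def)
      have "d (c + int a) = 0"
        by (rule less.IH) (use ab less.prems \<open>N \<ge> 1\<close> in auto)
      moreover have "d (c + int b) = 0"
        by (rule less.IH) (use ab less.prems \<open>N \<ge> 1\<close> in auto)
      moreover have "d (c + int a - N) + d (c + int a) + d (c + int a + N) = 0"
        using False less.prems assms(2,3) ab by (intro rec) auto
      ultimately show ?thesis using ab by (simp add: algebra_simps)
    qed (use win in auto)
  qed
  have down: "p \<le> c + 2 * N - 1 - int n \<Longrightarrow> d (c + 2 * N - 1 - int n) = 0" for n
  proof (induction n rule: less_induct)
    case (less n)
    show ?case
    proof (cases "int n < 2 * N")
      case False
      define a b where "a = nat (int n - N)" and "b = nat (int n - 2 * N)"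
      have ab: "int a = int n - N" "int b = int n - 2 * N" "a < n" "b < n"
        using False \<open>N \<ge> 1\<close> by (auto simp: a_def b_def)
      have "d (c + 2 * N - 1 - int a) = 0"
        by (rule less.IH) (use ab less.prems \<open>N \<ge> 1\<close> in auto)
      moreover have "d (c + 2 * N - 1 - int b) = 0"
        by (rule less.IH) (use ab less.prems \<open>N \<ge> 1\<close> in auto)
      moreover have "d (c + 2 * N - 1 - int a - N) + d (c + 2 * N - 1 - int a)
          + d (c + 2 * N - 1 - int a + N) = 0"
        using False less.prems assms(2,4) ab by (intro rec) auto
      ultimately show ?thesis using ab by (simp add: algebra_simps)
    qed (use win in auto)
  qed
  show ?thesis
  proof (cases "c \<le> x")
    case True
    then show ?thesis using up[of "nat (x - c)"] \<open>x \<le> q\<close> by simp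
  next
    case False
    then show ?thesis
      using down[of "nat (c + 2 * N - 1 - x)"] \<open>p \<le> x\<close> \<open>N \<ge> 1\<close> by simp
  qed
qed

lemma recurrence_zero_all:
  fixes d :: "int \<Rightarrow> bit"
  assumes "\<And>x. d (x - N) + d x + d (x + N) = 0" "N \<ge> 1"
    and "\<And>x. c \<le> x \<Longrightarrow> x < c + 2 * N \<Longrightarrow> d x = 0"
  shows "d = (\<lambda>_. 0)"
proof
  fix x
  show "d x = 0"
    by (rule recurrence_zero[of "min c x" N "max x (c + 2 * N)" d c])
      (use assms(2) in \<open>simp_all add: assms(1,3)\<close>)
qed

text \<open>The pattern 0, 1, 1 of period 3, spread out to the multiples of \<open>N\<close>. Read backwards in time,
  a row \<open>pat (2 ^ k)\<close> is what stands \<open>2 ^ k\<close> steps above the top of every large void.\<close>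

definition pat :: "int \<Rightarrow> int \<Rightarrow> bit" where
  "pat N y = (if N dvd y \<and> \<not> 3 * N dvd y then 1 else 0)"

lemma pat_mult: "N \<noteq> 0 \<Longrightarrow> pat N (N * z) = (if 3 dvd z then 0 else 1)"
  by (simp add: pat_def mult.commute[of 3])

lemma three_dvd_cases:
  "3 dvd z \<and> \<not> 3 dvd z - 1 \<and> \<not> 3 dvd z + 1 \<or> \<not> 3 dvd z \<and> 3 dvd z - 1 \<and> \<not> 3 dvd z + 1 \<or>
     \<not> 3 dvd z \<and> \<not> 3 dvd z - 1 \<and> 3 dvd z + (1 :: int)"
  by presburger

text \<open>Among three consecutive multiples of \<open>N\<close> exactly one is a multiple of
  \<open>3 * N\<close>, so two 1s cancel.\<close>

lemma pat_rec:
  assumes "N \<noteq> 0"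
  shows "pat N (y - N) + pat N y + pat N (y + N) = 0"
proof (cases "N dvd y")
  case True
  then obtain z where y: "y = N * z" by blast
  have d: "y - N = N * (z - 1)" "y + N = N * (z + 1)" by (auto simp: y algebra_simps)
  show ?thesis
    using three_dvd_cases[of z] unfolding d unfolding y pat_mult[OF assms] by (elim disjE) simp_all
next
  case False
  then show ?thesis by (auto simp: pat_def dvd_diff_left_iff)
qed

text \<open>Off the multiples of \<open>N\<close> = \<open>2 ^ k\<close> both sides vanish. At
  \<open>N * z\<close> with \<open>z\<close> even only the middle term can be 1; with
  \<open>z\<close> odd only the outer ones, and these cancel exactly if 3 divides
  \<open>z\<close>.\<close>

lemma pat_one3: "(one3 ^^ (2 ^ k)) (pat (2 ^ Suc k)) = pat (2 ^ k)"
proof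
  fix y :: int
  define N :: int where "N = 2 ^ k"
  have N: "N \<noteq> 0" by (auto simp: N_def)
  have "pat (2 * N) (y - N) + pat (2 * N) y + pat (2 * N) (y + N) = pat N y"
  proof (cases "N dvd y")
    case True
    then obtain z where y: "y = N * z" by blast
    have d: "y - N = N * (z - 1)" "y + N = N * (z + 1)" by (auto simp: y algebra_simps)
    have "6 dvd w \<longleftrightarrow> even w \<and> 3 dvd w" for w :: int by presburger
    then have e: "pat (2 * N) (N * w) = (if even w \<and> \<not> 3 dvd w then 1 else 0)" for w
      using N by (auto simp add: pat_def mult.commute[of _ N])
    show ?thesis
      using three_dvd_cases[of z] unfolding d unfolding y pat_mult[OF N] e
      by (cases "even z"; elim disjE) simp_all
  next
    case False
    then have "\<not> 2 * N dvd y" "\<not> 2 * N dvd y + N" "\<not> 2 * N dvd y - N"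
      using dvd_mult_right[of 2 N y] dvd_mult_right[of 2 N "y + N"] dvd_mult_right[of 2 N "y - N"]
      by (auto simp: dvd_diff_left_iff)
    then show ?thesis using False by (auto simp: pat_def)
  qed
  then show "(one3 ^^ (2 ^ k)) (pat (2 ^ Suc k)) y = pat (2 ^ k) y"
    by (simp add: one3_pow2 N_def)
qed

text \<open>The steps of \<open>pat_one3\<close> at the levels from \<open>k - 1\<close> down to
  \<open>j\<close> add up to \<open>2 ^ k - 2 ^ j\<close>.\<close>

lemma pat_one3_diff: "j \<le> k \<Longrightarrow> (one3 ^^ (2 ^ k - 2 ^ j)) (pat (2 ^ k)) = pat (2 ^ j)"
proof (induction k)
  case (Suc k)
  show ?case
  proof (cases "j = Suc k")
    case False
    with Suc have "(one3 ^^ (2 ^ k - 2 ^ j)) (pat (2 ^ k)) = pat (2 ^ j)" by simp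
    moreover have "(2::nat) ^ j \<le> 2 ^ k" using False Suc.prems by (intro power_increasing) auto
    then have "(2::nat) ^ Suc k - 2 ^ j = (2 ^ k - 2 ^ j) + 2 ^ k" by simp
    ultimately show ?thesis by (simp only: funpow_add o_def pat_one3)
  qed auto
qed auto

text \<open>After \<open>2 ^ k - 1\<close> steps the row is \<open>pat 1\<close>, which is not zero;
  a row that had died earlier would have stayed zero.\<close>

lemma pat_pow_nonzero:
  assumes "n < 2 ^ k"
  shows "(one3 ^^ n) (pat (2 ^ k)) \<noteq> (\<lambda>_. 0)"
proof
  assume z: "(one3 ^^ n) (pat (2 ^ k)) = (\<lambda>_. 0)"
  have "2 ^ k - 2 ^ 0 = (2 ^ k - 1 - n) + n" using assms by auto
  then have "pat 1 = (\<lambda>_. 0)"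
    using pat_one3_diff[of 0 k] z by (simp add: funpow_add)
  then have "pat 1 1 = 0" by (rule fun_cong)
  then show False by (simp add: pat_def)
qed

text \<open>The recurrence says that \<open>2 ^ k\<close> steps annihilate \<open>w\<close>, and
  powers of the rule commute.\<close>

lemma one3_pow_rec:
  assumes "\<And>x. w (x - 2 ^ k) + w x + w (x + 2 ^ k) = 0"
  shows "(one3 ^^ n) w (x - 2 ^ k) + (one3 ^^ n) w x + (one3 ^^ n) w (x + 2 ^ k) = 0"
proof -
  have "(one3 ^^ (2 ^ k)) ((one3 ^^ n) w) = (one3 ^^ n) ((one3 ^^ (2 ^ k)) w)"
    by (metis add.commute comp_apply funpow_add)
  also have "(one3 ^^ (2 ^ k)) w = (\<lambda>_. 0)" using assms by (auto simp: one3_pow2)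
  finally show ?thesis using one3_pow2[of k "(one3 ^^ n) w" x] by simp
qed

section \<open>Voids\<close>

definition pulse :: "nat \<Rightarrow> int \<Rightarrow> bit" where
  "pulse t = (one3 ^^ t) (\<lambda>y. if y = 0 then 1 else 0)"

lemma pulse_0: "pulse 0 x = (if x = 0 then 1 else 0)"
  by (simp add: pulse_def)

lemma pulse_Suc: "pulse (Suc t) x = pulse t (x - 1) + pulse t x + pulse t (x + 1)"
  by (simp add: pulse_def one3_def)

lemma pulse_add: "pulse (s + t) = (one3 ^^ s) (pulse t)"
  by (simp add: pulse_def funpow_add)

lemma pulse_outside: "\<bar>x\<bar> > int t \<Longrightarrow> pulse t x = 0"
  by (induction t arbitrary: x) (auto simp: pulse_0 pulse_Suc)

lemma pulse_edges: "pulse t (int t) = 1" "pulse t (- int t) = 1"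
  by (induction t) (auto simp: pulse_0 pulse_Suc pulse_outside)

text \<open>By \<open>one3_pow2\<close>, a jump of \<open>2 ^ k\<close> steps only moves values by
  multiples of \<open>2 ^ k\<close>, and the start is supported at 0.\<close>

lemma pulse_dvd: "\<not> 2 ^ k dvd x \<Longrightarrow> pulse (m * 2 ^ k) x = 0"
proof (induction m arbitrary: x)
  case 0
  then show ?case by (auto simp: pulse_0)
next
  case (Suc m)
  then show ?case by (simp add: pulse_add one3_pow2 dvd_diff_left_iff)
qed

section \<open>The pattern \<Lambda> in terms of bits\<close>

lemma of_nat_mod2_bit: "(of_nat (n mod 2) :: bit) = of_nat n"
  by (cases "even n") (auto elim!: evenE oddE simp: mod2_eq_if)

lemma one_or_three_bit:
  "(of_nat (one_or_three \<zeta> t x) :: bit) = (one3 ^^ t) (\<lambda>y. of_nat (\<zeta> y)) x"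
proof (induction t arbitrary: x)
  case (Suc t)
  then show ?case by (simp add: one3_def of_nat_mod2_bit)
qed auto

lemma one_or_three_less: "(\<And>y. \<zeta> y < 2) \<Longrightarrow> one_or_three \<zeta> t x < 2"
  by (cases t) auto

lemma Lambda_iff: "(x, t) \<in> \<Lambda> \<longleftrightarrow> t \<ge> 0 \<and> pulse (nat t) x = 1"
proof -
  let ?z = "\<lambda>y::int. if y = 0 then 1 else (0::nat)"
  have "one_or_three ?z n x = 1 \<longleftrightarrow> pulse n x = 1" for n
  proof -
    have "of_nat (one_or_three ?z n x) = pulse n x"
      by (simp add: one_or_three_bit pulse_def if_distrib cong: if_cong)
    moreover have "one_or_three ?z n x < 2"
      by (rule one_or_three_less) auto
    then have "one_or_three ?z n x = 0 \<or> one_or_three ?z n x = 1" by linarith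
    ultimately show ?thesis by auto
  qed
  moreover have "(x, t) \<in> \<Lambda> \<longleftrightarrow> (\<exists>n. t = int n \<and> one_or_three ?z n x = 1)"
    unfolding \<Lambda>_def by blast
  ultimately show ?thesis by (metis nat_int nat_0_le of_nat_0_le_iff)
qed

text \<open>Such a row is fixed by its values at two consecutive multiples of \<open>N\<close>. The
  pair 0, 0 gives the zero row, and each other pair occurs in the pattern 0, 1, 1.\<close>

lemma scaled_pattern:
  fixes g :: "int \<Rightarrow> bit"
  assumes sp: "\<And>x. \<not> N dvd x \<Longrightarrow> g x = 0"
    and rec: "\<And>x. p + N \<le> x \<Longrightarrow> x \<le> q - N \<Longrightarrow> g (x - N) + g x + g (x + N) = 0"
    and N: "N \<ge> 1" "q - p \<ge> 3 * N"
  shows "(\<forall>x\<in>{p..q}. g x = 0) \<or> (\<exists>a. \<forall>x\<in>{p..q}. g x = pat N (x - a))"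
proof -
  \<comment> \<open>\<open>N * j\<close> is the least multiple of \<open>N\<close> that is at least
    \<open>p\<close>; the length of the interval leaves room for a window of \<open>2 * N\<close>
    cells from there.\<close>
  define j where "j = (p + N - 1) div N"
  have "N * j \<le> p + N - 1" "N * j > p - 1"
    using N minus_mod_eq_mult_div[of "p + N - 1" N] pos_mod_bound[of N "p + N - 1"]
      pos_mod_sign[of N "p + N - 1"] unfolding j_def by linarith+
  then have j: "p \<le> N * j" "N * j + 2 * N - 1 \<le> q" using N by auto
  have mult: "x = N * j \<or> x = N * (j + 1)"
    if "N dvd x" "N * j \<le> x" "x < N * j + 2 * N" for x
  proof -
    from that obtain z where z: "x = N * z" by blast
    have "N * z < N * (j + 2)" "N * j \<le> N * z" using that z by (auto simp: algebra_simps)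
    then have "z < j + 2" "j \<le> z" using N by auto
    then show ?thesis using z by (cases "z = j") auto
  qed
  have ext: "\<forall>x\<in>{p..q}. g x = h x"
    if "\<And>x. h (x - N) + h x + h (x + N) = 0" "\<And>x. \<not> N dvd x \<Longrightarrow> h x = 0"
      "g (N * j) = h (N * j)" "g (N * (j + 1)) = h (N * (j + 1))" for h
  proof
    fix x assume "x \<in> {p..q}"
    have "g x + h x = 0"
    proof (rule recurrence_zero[where d = "\<lambda>x. g x + h x" and c = "N * j" and N = N and p = p and q = q])
      fix x assume "p + N \<le> x" "x \<le> q - N"
      then have "(g (x - N) + g x + g (x + N)) + (h (x - N) + h x + h (x + N)) = 0"
        using rec that(1) by simp
      then show "g (x - N) + h (x - N) + (g x + h x) + (g (x + N) + h (x + N)) = 0"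
        by (simp add: algebra_simps)
    next
      fix x assume x: "N * j \<le> x" "x < N * j + 2 * N"
      have "g x = h x"
      proof (cases "N dvd x")
        case True
        with x have "x = N * j \<or> x = N * (j + 1)" by (intro mult)
        then show ?thesis using that(3,4) by (elim disjE) simp_all
      qed (simp add: sp that(2))
      then show "g x + h x = 0" by simp
    qed (use N j \<open>x \<in> {p..q}\<close> in simp_all)
    then show "g x = h x" by (rule bit_eq_if_add_zero)
  qed
  have patv: "pat N (N * i) = (if 3 dvd i then 0 else 1)" for i
    by (rule pat_mult) (use N in simp)
  have shift: "\<forall>x\<in>{p..q}. g x = pat N (x - N * i)"
    if "g (N * j) = pat N (N * (j - i))" "g (N * (j + 1)) = pat N (N * (j + 1 - i))" for i
  proof (rule ext)
    show "pat N (x - N - N * i) + pat N (x - N * i) + pat N (x + N - N * i) = 0" for x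
      using pat_rec[of N "x - N * i"] N by (simp add: algebra_simps)
    show "pat N (x - N * i) = 0" if "\<not> N dvd x" for x
      using that by (auto simp: pat_def dvd_diff_left_iff)
  qed (use that in \<open>simp_all add: right_diff_distrib distrib_left add_diff_eq\<close>)
  \<comment> \<open>In the three nonzero cases the shift puts the 0 of the pattern at index
    \<open>j\<close>, \<open>j + 1\<close> or \<open>j - 1\<close>.\<close>
  show ?thesis
  proof (cases "g (N * j)"; cases "g (N * (j + 1))")
    assume "g (N * j) = 0" "g (N * (j + 1)) = 0"
    then show ?thesis using ext[of "\<lambda>_. 0"] by auto
  next
    assume g: "g (N * j) = 0" "g (N * (j + 1)) = 1"
    show ?thesis
      by (intro disjI2 exI[of _ "N * (j)"] shift) (simp_all only: patv g, simp_all)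
  next
    assume g: "g (N * j) = 1" "g (N * (j + 1)) = 0"
    show ?thesis
      by (intro disjI2 exI[of _ "N * (j + 1)"] shift) (simp_all only: patv g, simp_all)
  next
    assume g: "g (N * j) = 1" "g (N * (j + 1)) = 1"
    show ?thesis
      by (intro disjI2 exI[of _ "N * (j - 1)"] shift) (simp_all only: patv g, simp_all)
  qed
qed

text \<open>The top row of an inverted triangle of zeros. The last conjunct excludes gaps that
  merely continue a wider gap of the row before.\<close>

definition void :: "nat \<Rightarrow> int \<Rightarrow> int \<Rightarrow> bool" where
  "void t p q \<longleftrightarrow> t \<ge> 1 \<and> p \<le> q \<and> (\<forall>x\<in>{p..q}. pulse t x = 0) \<and>
     pulse t (p - 1) = 1 \<and> pulse t (q + 1) = 1 \<and> (\<exists>x\<in>{p - 1..q + 1}. pulse (t - 1) x = 1)"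

text \<open>The zeros of the top row impose the recurrence with step 1 on the row above, so two
  adjacent zeros there would clear it from \<open>p - 1\<close> to \<open>q + 1\<close>.\<close>

lemma void_above:
  assumes v: "void t p q" and "p - 1 \<le> c" "c \<le> q"
  shows "pulse (t - 1) c = 1 \<or> pulse (t - 1) (c + 1) = 1"
proof (rule ccontr)
  assume "\<not> ?thesis"
  then have z: "pulse (t - 1) c = 0" "pulse (t - 1) (c + 1) = 0" by auto
  obtain y where y: "p - 1 \<le> y" "y \<le> q + 1" "pulse (t - 1) y = 1"
    using v by (auto simp: void_def)
  have "pulse (t - 1) y = 0"
  proof (rule recurrence_zero[where d = "pulse (t - 1)" and c = c and N = 1 and p = "p - 1" and q = "q + 1"])
    fix x assume "p - 1 + 1 \<le> x" "x \<le> q + 1 - 1"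
    then have "pulse (Suc (t - 1)) x = 0" using v by (simp add: void_def)
    then show "pulse (t - 1) (x - 1) + pulse (t - 1) x + pulse (t - 1) (x + 1) = 0"
      by (simp only: pulse_Suc)
  next
    fix x assume "c \<le> x" "x < c + 2 * 1"
    then have "x = c \<or> x = c + 1" by linarith
    then show "pulse (t - 1) x = 0" using z by auto
  qed (use y assms in auto)
  with y show False by simp
qed

text \<open>Rows at multiples of \<open>2 ^ k\<close> live on the multiples of \<open>2 ^ k\<close>,
  and under a wide gap they obey the recurrence, so they are zero or a shifted \<open>pat\<close>. A
  zero row would clear the row above the void; a shifted \<open>pat\<close> cannot die in fewer than
  \<open>2 ^ k\<close> steps. Hence the void starts exactly \<open>2 ^ k\<close> steps below a
  shifted \<open>pat\<close>.\<close>

lemma large_void: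
  assumes v: "void t p q" and w: "q - p \<ge> 6 * 2 ^ k"
  shows "2 ^ k \<le> t \<and> (\<exists>a. \<forall>x\<in>{p - 2 ^ k..q + 2 ^ k}. pulse (t - 2 ^ k) x = pat (2 ^ k) (x - a))"
proof -
  define N :: nat where "N = 2 ^ k"
  define m where "m = t div N"
  have iN: "int N = 2 ^ k" and N: "N \<ge> 1" by (simp_all add: N_def)
  have w': "q - p \<ge> 6 * int N" using w by (simp add: iN)
  have tz: "pulse t x = 0" if "p \<le> x" "x \<le> q" for x using v that by (auto simp: void_def)
  have t1: "t \<ge> 1" using v by (auto simp: void_def)
  \<comment> \<open>The row above a void has no two adjacent zeros, so it cannot vanish on this
    inner interval.\<close>
  have nz: False if "\<And>x. p + N \<le> x \<Longrightarrow> x \<le> q - N \<Longrightarrow> pulse (t - 1) x = 0"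
    using void_above[OF v, of "p + N"] that[of "p + N"] that[of "p + N + 1"] w' N by auto
  have "N dvd t"
  proof (rule ccontr)
    define \<tau> where "\<tau> = t mod N"
    assume "\<not> N dvd t"
    then have \<tau>: "0 < \<tau>" "\<tau> < N" using N by (auto simp: \<tau>_def dvd_eq_mod_eq_0)
    have t: "t = \<tau> + m * N" by (simp add: \<tau>_def m_def)
    \<comment> \<open>The next multiple of \<open>N\<close> after \<open>t\<close> is
      \<open>N - \<tau>\<close> steps later, where the triangle is still zero; seen from
      \<open>N\<close> steps earlier, these zeros are the recurrence.\<close>
    have rec: "pulse (m * N) (x - N) + pulse (m * N) x + pulse (m * N) (x + N) = 0"
      if "p + N \<le> x" "x \<le> q - N" for x
    proof -
      have "(one3 ^^ (N - \<tau>)) (pulse t) x = 0"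
        by (rule one3_pow_local_zero[where p = p and q = q]) (use tz that \<tau> in auto)
      moreover have "(one3 ^^ (N - \<tau>)) (pulse t) = (one3 ^^ N) (pulse (m * N))"
        using \<tau> by (simp flip: pulse_add add: t)
      ultimately show ?thesis
        using one3_pow2[of k "pulse (m * N)" x] by (simp add: N_def)
    qed
    have "(\<forall>x\<in>{p..q}. pulse (m * N) x = 0) \<or> (\<exists>a. \<forall>x\<in>{p..q}. pulse (m * N) x = pat N (x - a))"
      by (rule scaled_pattern) (use rec w' N pulse_dvd[of k _ m] in \<open>auto simp flip: iN N_def\<close>)
    then show False
    proof (elim disjE exE)
      assume z: "\<forall>x\<in>{p..q}. pulse (m * N) x = 0"
      have t': "t - 1 = (\<tau> - 1) + m * N" using \<tau> t by simp
      show False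
        by (rule nz, unfold t' pulse_add, rule one3_pow_local_zero[where p = p and q = q])
          (use z \<tau> in auto)
    next
      fix a assume a: "\<forall>x\<in>{p..q}. pulse (m * N) x = pat N (x - a)"
      have eq: "(one3 ^^ \<tau>) (pat N) (x - a) = 0" if "p + N \<le> x" "x \<le> q - N" for x
      proof -
        have "(one3 ^^ \<tau>) (pulse (m * N)) x = (one3 ^^ \<tau>) (\<lambda>x. pat N (x - a)) x"
          by (rule one3_pow_local[where p = p and q = q]) (use a \<tau> that in auto)
        also have "(one3 ^^ \<tau>) (pulse (m * N)) x = 0"
          using tz[of x] that N by (simp flip: pulse_add add: t)
        finally show ?thesis by (simp add: one3_pow_shift)
      qed
      \<comment> \<open>The inner interval has room for \<open>2 * N\<close> consecutive zeros,
        which by the recurrence clear the entire row.\<close>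
      have "(one3 ^^ \<tau>) (pat N) = (\<lambda>_. 0)"
      proof (rule recurrence_zero_all[where N = N and c = "p + N - a"])
        show "(one3 ^^ \<tau>) (pat N) (x - int N) + (one3 ^^ \<tau>) (pat N) x + (one3 ^^ \<tau>) (pat N) (x + int N) = 0" for x
          unfolding iN by (rule one3_pow_rec, rule pat_rec) auto
        show "(one3 ^^ \<tau>) (pat N) x = 0" if "p + N - a \<le> x" "x < p + N - a + 2 * int N" for x
          using eq[of "x + a"] that w' N by simp
      qed (use N in auto)
      then show False using pat_pow_nonzero[of \<tau> k] \<tau> by (simp add: N_def)
    qed
  qed
  then have Nt: "N \<le> t" and "t = m * N" using t1 by (auto simp: m_def dvd_imp_le)
  then have tN: "t - N = (m - 1) * N" by (simp add: diff_mult_distrib)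
  have rec: "pulse (t - N) (x - N) + pulse (t - N) x + pulse (t - N) (x + N) = 0"
      if "p - N + N \<le> x" "x \<le> q + N - N" for x
    using tz[of x] that one3_pow2[of k "pulse (t - N)" x] Nt pulse_add[of N "t - N"]
    by (simp add: N_def)
  have "(\<forall>x\<in>{p - N..q + N}. pulse (t - N) x = 0) \<or>
      (\<exists>a. \<forall>x\<in>{p - N..q + N}. pulse (t - N) x = pat N (x - a))"
    by (rule scaled_pattern) (use rec w' N pulse_dvd[of k _ "m - 1"] in \<open>auto simp flip: iN N_def simp: tN\<close>)
  moreover have False if z: "\<forall>x\<in>{p - N..q + N}. pulse (t - N) x = 0"
  proof (rule nz)
    fix x :: int assume x: "p + N \<le> x" "x \<le> q - N"
    have "t - 1 = (N - 1) + (t - N)" using Nt N by simp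
    then show "pulse (t - 1) x = 0"
      by (simp only: pulse_add, intro one3_pow_local_zero[where p = "p - N" and q = "q + N"])
        (use z x N in auto)
  qed
  ultimately have "\<exists>a. \<forall>x\<in>{p - N..q + N}. pulse (t - N) x = pat N (x - a)" by blast
  with Nt show ?thesis unfolding iN[symmetric] N_def[symmetric] by blast
qed

lemma void_triangle_zero:
  assumes "void t p q" "p + int n \<le> x" "x \<le> q - int n"
  shows "pulse (t + n) x = 0"
proof -
  have "(one3 ^^ n) (pulse t) x = 0"
    by (rule one3_pow_local_zero[OF _ assms(2,3)]) (use assms(1) in \<open>simp add: void_def\<close>)
  then show ?thesis by (simp only: pulse_add[symmetric] add.commute)
qed

text \<open>A boundary 1 moves inwards by one cell per step: the first zero beside it sees that 1
  and, as long as the gap is wide enough, two zeros.\<close>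

lemma void_triangle_boundary:
  assumes "void t p q" "p + int n \<le> q - int n"
  shows "pulse (t + n) (p + int n - 1) = 1 \<and> pulse (t + n) (q - int n + 1) = 1"
  using assms(2)
proof (induction n)
  case 0
  then show ?case using assms(1) by (auto simp: void_def)
next
  case (Suc n)
  then have "pulse (t + n) (p + int n - 1) = 1 \<and> pulse (t + n) (q - int n + 1) = 1" by auto
  moreover have "pulse (t + n) x = 0" if "p + int n \<le> x" "x \<le> q - int n" for x
    using void_triangle_zero[OF assms(1)] that by auto
  ultimately show ?case using Suc.prems by (simp add: pulse_Suc algebra_simps)
qed

text \<open>Go back in time until the gap is the top of a void. If the row before vanishes over the
  gap and its two boundary cells, the 1s at these cells come from 1s one cell further out, so the
  earlier gap is wider by one on each side.\<close>

lemma void_exists: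
  assumes "p \<le> q" "\<And>x. p \<le> x \<Longrightarrow> x \<le> q \<Longrightarrow> pulse t x = 0" "pulse t (p - 1) = 1" "pulse t (q + 1) = 1"
  shows "\<exists>t0 p0 q0 n. void t0 p0 q0 \<and> t = t0 + n \<and> p = p0 + int n \<and> q = q0 - int n"
  using assms
proof (induction t arbitrary: p q)
  case 0
  then have "p - 1 = 0" "q + 1 = 0" by (auto simp: pulse_0 split: if_splits)
  with 0 show ?case by auto
next
  case (Suc t)
  show ?case
  proof (cases "\<exists>x\<in>{p - 1..q + 1}. pulse t x = 1")
    case True
    then have "void (Suc t) p q" using Suc.prems by (auto simp: void_def)
    then show ?thesis by (intro exI[of _ "Suc t"] exI[of _ p] exI[of _ q] exI[of _ 0]) auto
  next
    case False
    then have z: "pulse t x = 0" if "p - 1 \<le> x" "x \<le> q + 1" for x using that by force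
    have "pulse t (p - 2) = 1" "pulse t (2 + q) = 1"
      using Suc.prems z[of "p - 1"] z[of p] z[of "q + 1"] z[of q]
        pulse_Suc[of t "p - 1"] pulse_Suc[of t "q + 1"] by (simp_all add: algebra_simps)
    then have "\<exists>t0 p0 q0 n. void t0 p0 q0 \<and> t = t0 + n \<and> p - 1 = p0 + int n \<and> q + 1 = q0 - int n"
      using z Suc.prems(1) by (intro Suc.IH) auto
    then obtain t0 p0 q0 n where "void t0 p0 q0 \<and> t = t0 + n \<and> p - 1 = p0 + int n \<and> q + 1 = q0 - int n"
      by blast
    then show ?thesis by (intro exI[of _ t0] exI[of _ p0] exI[of _ q0] exI[of _ "Suc n"]) auto
  qed
qed

text \<open>The edges of the cone are 1s, so a zero inside lies between a nearest 1 to the left and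
  one to the right.\<close>

lemma void_around:
  assumes "pulse t x = 0" "\<bar>x\<bar> \<le> int t"
  shows "\<exists>t0 p q n. void t0 p q \<and> t = t0 + n \<and> p + int n \<le> x \<and> x \<le> q - int n"
proof -
  let ?A = "{y\<in>{- int t..x}. pulse t y = 1}" and ?B = "{y\<in>{x..int t}. pulse t y = 1}"
  have fin: "finite ?A" "finite ?B"
    by (auto intro: finite_subset[of _ "{- int t..x}"] finite_subset[of _ "{x..int t}"])
  have ne: "?A \<noteq> {}" "?B \<noteq> {}" using assms pulse_edges[of t] by force+
  define a b where "a = Max ?A" and "b = Min ?B"
  have ab: "a \<in> ?A" "b \<in> ?B" unfolding a_def b_def by (rule Max_in[OF fin(1) ne(1)], rule Min_in[OF fin(2) ne(2)])
  have "pulse t y = 0" if "a < y" "y < b" for y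
  proof (rule ccontr)
    assume "pulse t y \<noteq> 0"
    then have "y \<in> ?A \<or> y \<in> ?B" using that ab by auto
    then have "y \<le> a \<or> b \<le> y"
      unfolding a_def b_def using Max_ge[OF fin(1)] Min_le[OF fin(2)] by blast
    with that show False by auto
  qed
  moreover have "a < x" "x < b" using ab assms(1) by (auto simp: order.order_iff_strict)
  moreover have "pulse t a = 1" "pulse t b = 1" using ab by auto
  ultimately have "\<exists>t0 p0 q0 n. void t0 p0 q0 \<and> t = t0 + n \<and> a + 1 = p0 + int n \<and> b - 1 = q0 - int n"
    by (intro void_exists) auto
  then obtain t0 p0 q0 n
    where "void t0 p0 q0 \<and> t = t0 + n \<and> a + 1 = p0 + int n \<and> b - 1 = q0 - int n"
    by blast
  then show ?thesis using \<open>a < x\<close> \<open>x < b\<close> by (intro exI[of _ t0] exI[of _ p0] exI[of _ q0] exI[of _ n]) auto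
qed

section \<open>Independence of the history\<close>

definition bit_of :: "state \<Rightarrow> bit" where
  "bit_of a = (if a = S1 then 1 else 0)"

lemma bit_of_simps [simp]: "bit_of S0 = 0" "bit_of S1 = 1" "bit_of S2 = 0"
  by (simp_all add: bit_of_def)

lemma delta_eq_iff: "\<delta> a = \<delta> b \<longleftrightarrow> bit_of a = bit_of b"
  by (simp add: \<delta>_def bit_of_def)

lemma bit_of_delta: "bit_of a = of_nat (\<delta> a)"
  by (simp add: \<delta>_def bit_of_def)

lemma delta_mod2_eq_1_iff:
  "(\<delta> a + \<delta> b + \<delta> c) mod 2 = 1 \<longleftrightarrow> bit_of a + bit_of b + bit_of c = 1"
  by (simp add: \<delta>_def bit_of_def)

lemma web_CA_bit_of:
  assumes "web_CA f"
  shows "bit_of (f a b c d e) = bit_of b + bit_of c + bit_of d"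
proof -
  have "\<delta> (f a b c d e) = (\<delta> b + \<delta> c + \<delta> d) mod 2" using assms by (simp add: web_CA_def)
  then have "of_nat (\<delta> (f a b c d e)) = (of_nat (\<delta> b + \<delta> c + \<delta> d) :: bit)"
    by (metis of_nat_mod2_bit)
  then show ?thesis by (simp add: bit_of_delta)
qed

lemma evolve_bit_of:
  assumes "web_CA f"
  shows "bit_of (evolve f \<zeta> t x) = (one3 ^^ t) (\<lambda>x. bit_of (\<zeta> x)) x"
  by (induction t arbitrary: x) (simp_all add: web_CA_bit_of[OF assms] one3_def)

lemma evolve_1_bit_of:
  assumes "web_CA f" "(\<lambda>x. bit_of (\<zeta> x)) = w"
  shows "(\<lambda>x. bit_of (evolve f \<zeta> 1 x)) = one3 w"
  unfolding assms(2)[symmetric] by (simp add: web_CA_bit_of[OF assms(1)] one3_def fun_eq_iff)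

lemma evolve_add: "evolve f \<zeta> (s + t) = evolve f (evolve f \<zeta> s) t"
  by (induction t) auto

lemma evolve_Suc_front: "evolve f \<zeta> (Suc t) = evolve f (evolve f \<zeta> 1) t"
  using evolve_add[of f \<zeta> 1 t] by simp

lemma evolve_shift: "evolve f (\<lambda>x. \<zeta> (x + a)) t x = evolve f \<zeta> t (x + a)"
  by (induction t arbitrary: x) (simp_all add: algebra_simps)

lemma evolve_local:
  assumes "\<And>y. x - 2 * int t \<le> y \<Longrightarrow> y \<le> x + 2 * int t \<Longrightarrow> \<zeta> y = \<zeta>' y"
  shows "evolve f \<zeta> t x = evolve f \<zeta>' t x"
  using assms by (induction t arbitrary: x) simp_all

text \<open>The row \<open>w\<close> of the web, and what the rule makes of it, determine the states \<open>n\<close> steps later,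
  no matter which of its zeros are \<open>S0\<close> and which are \<open>S2\<close>.\<close>

definition determined :: "rule \<Rightarrow> nat \<Rightarrow> (int \<Rightarrow> bit) \<Rightarrow> bool" where
  "determined f n w \<longleftrightarrow> (\<forall>\<zeta> \<zeta>'. (\<lambda>x. bit_of (\<zeta> x)) = w \<longrightarrow> (\<lambda>x. bit_of (\<zeta>' x)) = w \<longrightarrow>
     evolve f \<zeta> n = evolve f \<zeta>' n)"

text \<open>The positions from which a difference in the states on the row \<open>w\<close> may still be felt
  \<open>n\<close> steps later.\<close>

primrec diag_reach :: "nat \<Rightarrow> (int \<Rightarrow> bit) \<Rightarrow> int set" where
  "diag_reach 0 w = UNIV"
| "diag_reach (Suc n) w =
     {y. w y = 0 \<and> (y - 1 \<in> diag_reach n (one3 w) \<or> y + 1 \<in> diag_reach n (one3 w))}"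

primrec wide_reach :: "nat \<Rightarrow> (int \<Rightarrow> bit) \<Rightarrow> int set" where
  "wide_reach 0 w = UNIV"
| "wide_reach (Suc n) w =
     {y. w y = 0 \<and> (y \<in> wide_reach n (one3 w) \<or>
       y + 1 \<in> wide_reach n (one3 w) \<and> w (y + 1) = 0 \<or>
       y - 1 \<in> wide_reach n (one3 w) \<and> w (y - 1) = 0)}"

text \<open>Trace a difference back one step: only the states at \<open>x - 1\<close> and
  \<open>x + 1\<close> matter beyond the common web, and where states differ over the same web, the
  web is 0.\<close>

lemma diag_reach_if_differ:
  assumes f: "web_CA f" "diagonal_compliant f"
  shows "(\<lambda>x. bit_of (\<zeta> x)) = w \<Longrightarrow> (\<lambda>x. bit_of (\<zeta>' x)) = w \<Longrightarrow>
    evolve f \<zeta> n \<noteq> evolve f \<zeta>' n \<Longrightarrow> \<exists>y\<in>diag_reach n w. \<zeta> y \<noteq> \<zeta>' y"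
proof (induction n arbitrary: \<zeta> \<zeta>' w)
  case 0
  then show ?case by (auto simp: fun_eq_iff)
next
  case (Suc n)
  have bits: "bit_of (\<zeta> x) = w x" "bit_of (\<zeta>' x) = w x" for x
    using Suc.prems by (auto simp: fun_eq_iff)
  have "(\<lambda>x. bit_of (evolve f \<zeta> 1 x)) = one3 w" "(\<lambda>x. bit_of (evolve f \<zeta>' 1 x)) = one3 w"
    using Suc.prems(1,2) evolve_1_bit_of[OF f(1)] by blast+
  moreover have "evolve f (evolve f \<zeta> 1) n \<noteq> evolve f (evolve f \<zeta>' 1) n"
    using Suc.prems(3) unfolding evolve_Suc_front .
  ultimately obtain x where x: "x \<in> diag_reach n (one3 w)" "evolve f \<zeta> 1 x \<noteq> evolve f \<zeta>' 1 x"
    using Suc.IH by blast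
  have "\<zeta> (x - 1) \<noteq> \<zeta>' (x - 1) \<or> \<zeta> (x + 1) \<noteq> \<zeta>' (x + 1)"
  proof (rule ccontr)
    assume "\<not> ?thesis"
    then have "f (\<zeta> (x - 2)) (\<zeta> (x - 1)) (\<zeta> x) (\<zeta> (x + 1)) (\<zeta> (x + 2)) =
        f (\<zeta>' (x - 2)) (\<zeta>' (x - 1)) (\<zeta>' x) (\<zeta>' (x + 1)) (\<zeta>' (x + 2))"
      using f(2) bits unfolding diagonal_compliant_def delta_eq_iff by auto
    with x(2) show False by simp
  qed
  moreover have "w y = 0" if "\<zeta> y \<noteq> \<zeta>' y" for y
    using that bits[of y] by (cases "\<zeta> y"; cases "\<zeta>' y") auto
  ultimately have "x - 1 \<in> diag_reach (Suc n) w \<and> \<zeta> (x - 1) \<noteq> \<zeta>' (x - 1) \<or>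
      x + 1 \<in> diag_reach (Suc n) w \<and> \<zeta> (x + 1) \<noteq> \<zeta>' (x + 1)"
    using x(1) by simp blast
  then show ?case by blast
qed

text \<open>The reachable set is a union of whole runs of zeros. If a run were left in the middle,
  three adjacent zeros of \<open>w\<close> would give a zero below the middle cell, and the run
  there carries reachability on.\<close>

lemma wide_reach_run:
  "y \<in> wide_reach n w \<Longrightarrow> w (y + 1) = 0 \<Longrightarrow> y + 1 \<in> wide_reach n w"
  "y \<in> wide_reach n w \<Longrightarrow> w (y - 1) = 0 \<Longrightarrow> y - 1 \<in> wide_reach n w"
proof (induction n arbitrary: y w)
  case (Suc n)
  show "y + 1 \<in> wide_reach (Suc n) w" if y: "y \<in> wide_reach (Suc n) w" and w: "w (y + 1) = 0" for y w
  proof (cases "y \<in> wide_reach n (one3 w) \<or> y + 1 \<in> wide_reach n (one3 w)")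
    case True
    then show ?thesis using y w by auto
  next
    case False
    then have *: "y - 1 \<in> wide_reach n (one3 w)" "w (y - 1) = 0" "w y = 0" using y by auto
    then have "one3 w y = 0" using w by (simp add: one3_def)
    then have "y \<in> wide_reach n (one3 w)" using Suc.IH(1)[of "y - 1" "one3 w"] * by simp
    with False show ?thesis by simp
  qed
  show "y - 1 \<in> wide_reach (Suc n) w" if y: "y \<in> wide_reach (Suc n) w" and w: "w (y - 1) = 0" for y w
  proof (cases "y \<in> wide_reach n (one3 w) \<or> y - 1 \<in> wide_reach n (one3 w)")
    case True
    then show ?thesis using y w by auto
  next
    case False
    then have *: "y + 1 \<in> wide_reach n (one3 w)" "w (y + 1) = 0" "w y = 0" using y by auto
    then have "one3 w y = 0" using w by (simp add: one3_def)
    then have "y \<in> wide_reach n (one3 w)" using Suc.IH(2)[of "y + 1" "one3 w"] * by simp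
    with False show ?thesis by simp
  qed
qed simp_all

text \<open>Under a 0 of the web, a difference at any of the three inner cells is reachable by
  definition. Under a 1, exactly one neighbour is 0; either wide compliance hides its state, or the
  cell below that neighbour belongs to the same run of zeros as \<open>x\<close>, so that
  \<open>wide_reach_run\<close> applies.\<close>

lemma wide_reach_if_differ:
  assumes f: "web_CA f" "wide_compliant f"
  shows "(\<lambda>x. bit_of (\<zeta> x)) = w \<Longrightarrow> (\<lambda>x. bit_of (\<zeta>' x)) = w \<Longrightarrow>
    evolve f \<zeta> n \<noteq> evolve f \<zeta>' n \<Longrightarrow> \<exists>y\<in>wide_reach n w. \<zeta> y \<noteq> \<zeta>' y"
proof (induction n arbitrary: \<zeta> \<zeta>' w)
  case 0
  then show ?case by (auto simp: fun_eq_iff)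
next
  case (Suc n)
  note wide = f(2)[unfolded wide_compliant_def empty_compliant_def delta_eq_iff delta_mod2_eq_1_iff]
  have empty: "f a b c d e = f a' b c d e'" if "bit_of a = bit_of a'" "bit_of e = bit_of e'" for a b c d e a' e'
    using wide[THEN conjunct1] that by blast
  have right: "f a b S1 d e = f a' b S1 d' e'"
    if "bit_of a = bit_of a'" "bit_of d = bit_of d'" "bit_of e = bit_of e'" "1 + bit_of d + bit_of e = 1"
    for a b d e a' d' e'
    by (rule wide[THEN conjunct2, THEN conjunct1, rule_format]) (use that in simp_all)
  have left: "f a b S1 d e = f a' b' S1 d e'"
    if "bit_of a = bit_of a'" "bit_of b = bit_of b'" "bit_of e = bit_of e'" "bit_of a + bit_of b + 1 = 1"
    for a b d e a' b' e'
    by (rule wide[THEN conjunct2, THEN conjunct2, rule_format]) (use that in simp_all)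
  have bits: "bit_of (\<zeta> x) = w x" "bit_of (\<zeta>' x) = w x" for x
    using Suc.prems by (auto simp: fun_eq_iff)
  have S1: "\<zeta> x = S1" "\<zeta>' x = S1" if "w x = 1" for x
    using that bits[of x] by (auto simp: bit_of_def split: if_splits)
  have w0: "w y = 0" if "\<zeta> y \<noteq> \<zeta>' y" for y
    using that S1[of y] by (cases "w y") auto
  have b1: "(\<lambda>x. bit_of (evolve f \<zeta> 1 x)) = one3 w" "(\<lambda>x. bit_of (evolve f \<zeta>' 1 x)) = one3 w"
    using Suc.prems(1,2) evolve_1_bit_of[OF f(1)] by blast+
  moreover have "evolve f (evolve f \<zeta> 1) n \<noteq> evolve f (evolve f \<zeta>' 1) n"
    using Suc.prems(3) unfolding evolve_Suc_front .
  ultimately obtain x where x: "x \<in> wide_reach n (one3 w)" "evolve f \<zeta> 1 x \<noteq> evolve f \<zeta>' 1 x"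
    using Suc.IH by blast
  let ?F = "\<lambda>\<zeta>. f (\<zeta> (x - 2)) (\<zeta> (x - 1)) (\<zeta> x) (\<zeta> (x + 1)) (\<zeta> (x + 2))"
  have F: "?F \<zeta> \<noteq> ?F \<zeta>'" using x(2) by simp
  \<comment> \<open>A web cell with value 1 is in state \<open>S1\<close> in both evolutions, so no
    difference can sit there.\<close>
  have "one3 w x = 0"
  proof (rule ccontr)
    assume "one3 w x \<noteq> 0"
    then have "bit_of (evolve f \<zeta> 1 x) = 1" "bit_of (evolve f \<zeta>' 1 x) = 1"
      using fun_cong[OF b1(1), of x] fun_cong[OF b1(2), of x] by (simp_all del: evolve.simps)
    then show False using x(2) by (auto simp: bit_of_def split: if_splits)
  qed
  then have sum: "w (x - 1) + w x + w (x + 1) = 0" by (simp add: one3_def)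
  have differ: "\<zeta> (x - 1) \<noteq> \<zeta>' (x - 1) \<or> \<zeta> x \<noteq> \<zeta>' x \<or> \<zeta> (x + 1) \<noteq> \<zeta>' (x + 1)"
  proof (rule ccontr)
    assume "\<not> ?thesis"
    then have "?F \<zeta> = ?F \<zeta>'" using empty bits by auto
    with F show False by simp
  qed
  show ?case
  proof (cases "w x = 0")
    case True
    then show ?thesis
      using differ x(1) w0[of "x - 1"] w0[of x] w0[of "x + 1"]
      by (elim disjE) (rule bexI[of _ "x - 1"] bexI[of _ x] bexI[of _ "x + 1"]; simp)+
  next
    case False
    then have 1: "w x = 1" "\<zeta> x = S1" "\<zeta>' x = S1" using S1[of x] by auto
    then have "w (x - 1) = 0 \<and> w (x + 1) = 1 \<or> w (x - 1) = 1 \<and> w (x + 1) = 0"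
      using sum by (cases "w (x - 1)"; cases "w (x + 1)") auto
    then show ?thesis
    proof (elim disjE conjE)
      assume w: "w (x - 1) = 0" "w (x + 1) = 1"
      then have d: "\<zeta> (x - 1) \<noteq> \<zeta>' (x - 1)" using differ 1 S1[of "x + 1"] by auto
      \<comment> \<open>Otherwise the left triple is 0, 0, 1 with odd sum, and the rule would ignore
        the state at \<open>x - 1\<close>, the only inner one that differs.\<close>
      have "w (x - 2) \<noteq> 0"
      proof
        assume "w (x - 2) = 0"
        then have "?F \<zeta> = ?F \<zeta>'"
          using left[of "\<zeta> (x - 2)" "\<zeta>' (x - 2)" "\<zeta> (x - 1)" "\<zeta>' (x - 1)"] 1 w S1[of "x + 1"]
          by (simp add: bits)
        with F show False by simp
      qed
      then have "one3 w (x - 1) = 0" using w 1 by (simp add: one3_def)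
      then have "x - 1 \<in> wide_reach n (one3 w)" using x(1) wide_reach_run(2) by blast
      then show ?thesis using d w by (intro bexI[of _ "x - 1"]) auto
    next
      assume w: "w (x - 1) = 1" "w (x + 1) = 0"
      then have d: "\<zeta> (x + 1) \<noteq> \<zeta>' (x + 1)" using differ 1 S1[of "x - 1"] by auto
      have "w (x + 2) \<noteq> 0"
      proof
        assume "w (x + 2) = 0"
        then have "?F \<zeta> = ?F \<zeta>'"
          using right[of "\<zeta> (x - 2)" "\<zeta>' (x - 2)" "\<zeta> (x + 1)" "\<zeta>' (x + 1)"] 1 w S1[of "x - 1"]
          by (simp add: bits)
        with F show False by simp
      qed
      then have "one3 w (x + 1) = 0" using w 1 by (simp add: one3_def algebra_simps)
      then have "x + 1 \<in> wide_reach n (one3 w)" using x(1) wide_reach_run(1) by blast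
      then show ?thesis using d w by (intro bexI[of _ "x + 1"]) auto
    qed
  qed
qed

section \<open>Counting reachable positions\<close>

definition sol :: "nat \<Rightarrow> (int \<Rightarrow> bit) set" where
  "sol n = {w. (one3 ^^ n) w = (\<lambda>_. 0)}"

definition preimages :: "(int \<Rightarrow> bit) \<Rightarrow> (int \<Rightarrow> bit) set" where
  "preimages v = {w. one3 w = v}"

lemma one3_eqI:
  assumes "one3 w = one3 w'" "w y = w' y" "w (y + 1) = w' (y + 1)"
  shows "w = w'"
proof -
  have "(\<lambda>x. w x + w' x) = (\<lambda>_. 0)"
  proof (rule recurrence_zero_all[where N = 1 and c = y])
    fix x
    have "w (x - 1) + w' (x - 1) + (w x + w' x) + (w (x + 1) + w' (x + 1)) = one3 w x + one3 w' x"
      by (simp add: one3_def algebra_simps)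
    then show "w (x - 1) + w' (x - 1) + (w x + w' x) + (w (x + 1) + w' (x + 1)) = 0"
      by (simp add: assms(1))
  next
    fix x assume "y \<le> x" "x < y + 2 * 1"
    then have "x = y \<or> x = y + 1" by linarith
    then show "w x + w' x = 0" using assms(2,3) by auto
  qed simp
  then have "w x + w' x = 0" for x by (rule fun_cong)
  then show ?thesis by (intro ext) (rule bit_eq_if_add_zero)
qed

text \<open>The middle bit is recovered from the image at \<open>y\<close> and the two outer bits,
  which reduces this to two adjacent bits.\<close>

lemma one3_eqI':
  assumes "one3 w = one3 w'" "w (y - 1) = w' (y - 1)" "w (y + 1) = w' (y + 1)"
  shows "w = w'"
proof (rule one3_eqI[OF assms(1) _ assms(3)])
  have "u y = one3 u y + u (y - 1) + u (y + 1)" for u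
    by (simp add: one3_def algebra_simps)
  then have "w y = one3 w y + w (y - 1) + w (y + 1)" "w' y = one3 w' y + w' (y - 1) + w' (y + 1)"
    by blast+
  then show "w y = w' y" using assms by metis
qed

lemma bit_pairs: "{0, 1} \<times> {0, 1} = (UNIV :: (bit \<times> bit) set)"
proof -
  have "UNIV = {0, 1 :: bit}" by (rule UNIV_eq_I) (metis bit.exhaust insertCI)
  from this[symmetric] show ?thesis by simp
qed

lemma finite_bit_pairs [simp]: "finite (A :: (bit \<times> bit) set)"
  by (rule finite_subset[OF subset_UNIV]) (simp add: bit_pairs[symmetric])

lemma sum_bit_pairs_le:
  fixes h :: "bit \<Rightarrow> bit \<Rightarrow> nat"
  assumes "inj_on (\<lambda>w. (p w, q w)) A"
  shows "(\<Sum>w\<in>A. h (p w) (q w)) \<le> h 0 0 + h 0 1 + h 1 0 + h 1 1"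
proof -
  have "(\<Sum>w\<in>A. h (p w) (q w)) = (\<Sum>(a, b)\<in>(\<lambda>w. (p w, q w)) ` A. h a b)"
    by (subst sum.reindex[OF assms]) simp
  also have "\<dots> \<le> (\<Sum>(a, b)\<in>UNIV. h a b)"
    by (rule sum_mono2) simp_all
  also have "\<dots> = h 0 0 + h 0 1 + h 1 0 + h 1 1"
    by (simp add: bit_pairs[symmetric] sum.cartesian_product[symmetric])
  finally show ?thesis .
qed

text \<open>The two fresh bits of a backward step: a preimage is fixed by two adjacent bits, and
  also by two bits at distance 2. For upper bounds injectivity suffices.\<close>

lemma sum_preimages_le:
  fixes h :: "bit \<Rightarrow> bit \<Rightarrow> nat"
  shows "(\<Sum>w\<in>preimages v. h (w y) (w (y + 1))) \<le> h 0 0 + h 0 1 + h 1 0 + h 1 1"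
    and "(\<Sum>w\<in>preimages v. h (w (y - 1)) (w (y + 1))) \<le> h 0 0 + h 0 1 + h 1 0 + h 1 1"
proof (rule_tac [1-2] sum_bit_pairs_le)
  show "inj_on (\<lambda>w. (w y, w (y + 1))) (preimages v)"
    by (rule inj_onI, rule one3_eqI[of _ _ y]) (simp_all add: preimages_def)
  show "inj_on (\<lambda>w. (w (y - 1), w (y + 1))) (preimages v)"
    by (rule inj_onI, rule one3_eqI'[of _ _ y]) (simp_all add: preimages_def)
qed

lemma finite_preimages [simp]: "finite (preimages v)"
proof (rule inj_on_finite)
  show "inj_on (\<lambda>w. (w 0, w 1)) (preimages v)"
    by (rule inj_onI, rule one3_eqI[of _ _ 0]) (simp_all add: preimages_def)
qed auto

lemma sol_0: "sol 0 = {\<lambda>_. 0}"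
  by (auto simp: sol_def)

lemma sol_Suc: "sol (Suc n) = (\<Union>v\<in>sol n. preimages v)"
  by (auto simp: sol_def preimages_def funpow_swap1 simp del: funpow.simps) (simp_all add: funpow_swap1)

lemma finite_sol [simp]: "finite (sol n)"
  by (induction n) (auto simp: sol_0 sol_Suc)

lemma sum_sol_Suc: "(\<Sum>w\<in>sol (Suc n). F w) = (\<Sum>v\<in>sol n. \<Sum>w\<in>preimages v. F w)"
  unfolding sol_Suc by (rule sum.UNION_disjoint) (simp_all, auto simp: preimages_def)

lemma sol_mono: "m \<le> n \<Longrightarrow> sol m \<subseteq> sol n"
proof
  fix w assume "m \<le> n" "w \<in> sol m"
  then have "(one3 ^^ (n - m + m)) w = (\<lambda>_. 0)"
    unfolding funpow_add by (simp add: sol_def)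
  with \<open>m \<le> n\<close> show "w \<in> sol n" by (simp add: sol_def)
qed

lemma sol_rec: "w \<in> sol (2 ^ k) \<Longrightarrow> w (x - 2 ^ k) + w x + w (x + 2 ^ k) = 0"
  using one3_pow2[of k w x] by (simp add: sol_def)

text \<open>Adding two consecutive instances of the recurrence cancels the middle terms and equates
  values at distance \<open>3 * 2 ^ k\<close>.\<close>

lemma sol_periodic:
  assumes "w \<in> sol n" "n \<le> 2 ^ k"
  shows "w (x + 3 * 2 ^ k) = w x"
proof -
  have w: "w \<in> sol (2 ^ k)" using sol_mono[OF assms(2)] assms(1) by blast
  have "w x + w (x + 2 ^ k) + w (x + 2 * 2 ^ k) = 0"
    "w (x + 2 ^ k) + w (x + 2 * 2 ^ k) + w (x + 3 * 2 ^ k) = 0"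
    using sol_rec[OF w, of "x + 2 ^ k"] sol_rec[OF w, of "x + 2 * 2 ^ k"]
    by (simp_all add: algebra_simps)
  then show ?thesis
    by (cases "w x"; cases "w (x + 2 ^ k)"; cases "w (x + 2 * 2 ^ k)"; cases "w (x + 3 * 2 ^ k)") simp_all
qed

section \<open>Counts over one period\<close>

lemma periodic_mod:
  fixes g :: "int \<Rightarrow> 'a"
  assumes per: "\<And>y. g (y + P) = g y"
  shows "g (y mod P) = g y"
proof -
  have "g (y + P * k) = g y" for y k
  proof (induction k rule: int_induct[where k = 0])
    case (step1 i)
    then show ?case using per[of "y + P * i"] by (simp add: algebra_simps)
  next
    case (step2 i)
    then show ?case using per[of "y + P * (i - 1)"] by (simp add: algebra_simps)
  qed simp
  from this[of "y mod P" "y div P"] show ?thesis by (simp add: mod_mult_div_eq)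
qed

lemma sum_periodic_shift:
  fixes g :: "int \<Rightarrow> nat"
  assumes per: "\<And>y. g (y + P) = g y" and "P > 0"
  shows "(\<Sum>y\<in>{0..<P}. g (y + c)) = (\<Sum>y\<in>{0..<P}. g y)"
proof -
  have "g (y mod P) = g y" for y by (rule periodic_mod, rule per)
  then show ?thesis
    using \<open>P > 0\<close>
    by (intro sum.reindex_bij_witness[where i = "\<lambda>y. (y - c) mod P" and j = "\<lambda>y. (y + c) mod P"])
      (auto simp: mod_simps)
qed

definition period_count :: "int \<Rightarrow> int set \<Rightarrow> nat" where
  "period_count P S = (\<Sum>y\<in>{0..<P}. of_bool (y \<in> S))"

lemma period_count_UNIV: "period_count P UNIV = nat P"
  by (simp add: period_count_def)

lemma one3_periodic: "(\<And>x. w (x + P) = w x) \<Longrightarrow> one3 w (x + P) = one3 w x"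
proof -
  assume per: "\<And>x. w (x + P) = w x"
  show ?thesis using per[of "x - 1"] per[of x] per[of "x + 1"] by (simp add: one3_def algebra_simps)
qed

lemma diag_reach_periodic:
  "(\<And>x. w (x + P) = w x) \<Longrightarrow> y + P \<in> diag_reach n w \<longleftrightarrow> y \<in> diag_reach n w"
proof (induction n arbitrary: y w)
  case (Suc n)
  have "z + P \<in> diag_reach n (one3 w) \<longleftrightarrow> z \<in> diag_reach n (one3 w)" for z
    by (rule Suc.IH, rule one3_periodic, rule Suc.prems)
  from this[of "y - 1"] this[of "y + 1"] show ?case
    using Suc.prems[of y] by (simp add: algebra_simps)
qed simp

lemma wide_reach_periodic:
  "(\<And>x. w (x + P) = w x) \<Longrightarrow> y + P \<in> wide_reach n w \<longleftrightarrow> y \<in> wide_reach n w"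
proof (induction n arbitrary: y w)
  case (Suc n)
  have "z + P \<in> wide_reach n (one3 w) \<longleftrightarrow> z \<in> wide_reach n (one3 w)" for z
    by (rule Suc.IH, rule one3_periodic, rule Suc.prems)
  from this[of "y - 1"] this[of y] this[of "y + 1"] show ?case
    using Suc.prems[of "y - 1"] Suc.prems[of y] Suc.prems[of "y + 1"] by (simp add: algebra_simps)
qed simp

text \<open>For each \<open>y\<close> at most two of the four possible preimages have a 0 at
  \<open>y\<close>.\<close>

lemma diag_count_step1:
  "(\<Sum>w\<in>preimages v. period_count P (diag_reach (Suc n) w)) \<le>
     2 * period_count P {y. y - 1 \<in> diag_reach n v \<or> y + 1 \<in> diag_reach n v}"
proof -
  let ?N = "\<lambda>y. y - 1 \<in> diag_reach n v \<or> y + 1 \<in> diag_reach n v"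
  have "(\<Sum>w\<in>preimages v. period_count P (diag_reach (Suc n) w)) =
      (\<Sum>w\<in>preimages v. \<Sum>y\<in>{0..<P}. of_bool (w y = 0 \<and> ?N y))"
    by (intro sum.cong refl) (simp add: period_count_def preimages_def)
  also have "\<dots> = (\<Sum>y\<in>{0..<P}. \<Sum>w\<in>preimages v. of_bool (w y = 0 \<and> ?N y))"
    by (rule sum.swap)
  also have "\<dots> \<le> (\<Sum>y\<in>{0..<P}. 2 * of_bool (?N y))"
  proof (rule sum_mono)
    fix y
    show "(\<Sum>w\<in>preimages v. of_bool (w y = 0 \<and> ?N y)) \<le> 2 * (of_bool (?N y) :: nat)"
      using sum_preimages_le(1)[of "\<lambda>a _. of_bool (a = 0 \<and> ?N y)" y v] by simp
  qed
  also have "\<dots> = 2 * period_count P {y. ?N y}"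
    by (simp add: period_count_def sum_distrib_left)
  finally show ?thesis .
qed

text \<open>Each reachable \<open>y\<close> of the row \<open>v\<close> is charged for the position
  \<open>y\<close> itself, which needs a 0 at \<open>y - 1\<close> or at \<open>y + 1\<close> (3 of
  4 bit pairs), and for \<open>y - 2\<close> and \<open>y + 2\<close>, which need one specific 0
  each (2 of 4). Together 3 + 2 + 2 = 7.\<close>

lemma diag_count_step2:
  assumes per: "\<And>w x. w \<in> preimages v \<Longrightarrow> w (x + P) = w x" and "P > 0"
  shows "(\<Sum>w\<in>preimages v. period_count P {y. y - 1 \<in> diag_reach (Suc n) w \<or> y + 1 \<in> diag_reach (Suc n) w}) \<le>
     7 * period_count P (diag_reach n v)"
proof -
  let ?D = "diag_reach n v"
  have "(\<Sum>w\<in>preimages v. period_count P {y. y - 1 \<in> diag_reach (Suc n) w \<or> y + 1 \<in> diag_reach (Suc n) w}) \<le>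
      (\<Sum>w\<in>preimages v. \<Sum>y\<in>{0..<P}. of_bool (y \<in> ?D) * (of_bool (w (y - 1) = 0 \<or> w (y + 1) = 0) +
        of_bool (w (y - 1) = 0) + of_bool (w (y + 1) = 0)))"
  proof (rule sum_mono)
    fix w assume w: "w \<in> preimages v"
    then have v: "one3 w = v" by (simp add: preimages_def)
    have D: "y + P \<in> ?D \<longleftrightarrow> y \<in> ?D" for y
      unfolding v[symmetric] by (rule diag_reach_periodic) (rule one3_periodic, rule per[OF w])
    have per': "w (y + P - 1) = w (y - 1)" "w (y + P + 1) = w (y + 1)" for y
      using per[OF w, of "y - 1"] per[OF w, of "y + 1"] by (simp_all add: algebra_simps)
    \<comment> \<open>\<open>g\<close> and \<open>h\<close> are the charges for the positions two to
      the left and two to the right; periodicity allows moving them to the position that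
      pays.\<close>
    define g where "g = (\<lambda>y. of_bool (y \<in> ?D \<and> w (y - 1) = 0) :: nat)"
    define h where "h = (\<lambda>y. of_bool (y \<in> ?D \<and> w (y + 1) = 0) :: nat)"
    have "period_count P {y. y - 1 \<in> diag_reach (Suc n) w \<or> y + 1 \<in> diag_reach (Suc n) w} \<le>
        (\<Sum>y\<in>{0..<P}. of_bool (y \<in> ?D \<and> (w (y - 1) = 0 \<or> w (y + 1) = 0)) + g (y + 2) + h (y + (- 2)))"
      unfolding period_count_def
      by (rule sum_mono) (auto simp: g_def h_def v add.commute[of 1] add.commute[of 2])
    also have "\<dots> = (\<Sum>y\<in>{0..<P}. of_bool (y \<in> ?D \<and> (w (y - 1) = 0 \<or> w (y + 1) = 0)) + g y + h y)"
      unfolding sum.distrib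
      by (subst (1 2) sum_periodic_shift) (use \<open>P > 0\<close> in \<open>simp_all add: g_def h_def D per'\<close>)
    also have "\<dots> = (\<Sum>y\<in>{0..<P}. of_bool (y \<in> ?D) * (of_bool (w (y - 1) = 0 \<or> w (y + 1) = 0) +
        of_bool (w (y - 1) = 0) + of_bool (w (y + 1) = 0)))"
      by (rule sum.cong) (auto simp: g_def h_def)
    finally show "period_count P {y. y - 1 \<in> diag_reach (Suc n) w \<or> y + 1 \<in> diag_reach (Suc n) w} \<le> \<dots>" .
  qed
  also have "\<dots> = (\<Sum>y\<in>{0..<P}. \<Sum>w\<in>preimages v. of_bool (y \<in> ?D) * (of_bool (w (y - 1) = 0 \<or> w (y + 1) = 0) +
        of_bool (w (y - 1) = 0) + of_bool (w (y + 1) = 0)))"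
    by (rule sum.swap)
  also have "\<dots> \<le> (\<Sum>y\<in>{0..<P}. 7 * of_bool (y \<in> ?D))"
  proof (rule sum_mono)
    fix y
    show "(\<Sum>w\<in>preimages v. of_bool (y \<in> ?D) * (of_bool (w (y - 1) = 0 \<or> w (y + 1) = 0) +
        of_bool (w (y - 1) = 0) + of_bool (w (y + 1) = 0))) \<le> (7 * of_bool (y \<in> ?D) :: nat)"
      using sum_preimages_le(2)[of "\<lambda>a b. of_bool (y \<in> ?D) * (of_bool (a = 0 \<or> b = 0) +
        of_bool (a = 0) + of_bool (b = 0))" y v] by simp
  qed
  also have "\<dots> = 7 * period_count P ?D" by (simp add: period_count_def sum_distrib_left)
  finally show ?thesis .
qed

text \<open>Two backward steps give at most 16 preimages but multiply the count by at most 2 * 7 =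
  14. The base case is the zero row with its full period.\<close>

lemma diag_count_sol:
  assumes "2 * n \<le> 2 ^ k"
  shows "(\<Sum>w\<in>sol (2 * n). period_count (3 * 2 ^ k) (diag_reach (2 * n) w)) \<le> 14 ^ n * (3 * 2 ^ k)"
  using assms
proof (induction n)
  case 0
  then show ?case by (simp add: sol_0 period_count_UNIV nat_mult_distrib nat_power_eq)
next
  case (Suc n)
  let ?P = "3 * 2 ^ k :: int"
  have "(\<Sum>w\<in>sol (2 * Suc n). period_count ?P (diag_reach (2 * Suc n) w)) =
      (\<Sum>u\<in>sol (2 * n). \<Sum>v\<in>preimages u. \<Sum>w\<in>preimages v. period_count ?P (diag_reach (Suc (Suc (2 * n))) w))"
    by (simp add: sum_sol_Suc)
  also have "\<dots> \<le> (\<Sum>u\<in>sol (2 * n). 14 * period_count ?P (diag_reach (2 * n) u))"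
  proof (rule sum_mono)
    fix u assume u: "u \<in> sol (2 * n)"
    have "(\<Sum>v\<in>preimages u. \<Sum>w\<in>preimages v. period_count ?P (diag_reach (Suc (Suc (2 * n))) w)) \<le>
        (\<Sum>v\<in>preimages u. 2 * period_count ?P {y. y - 1 \<in> diag_reach (Suc (2 * n)) v \<or> y + 1 \<in> diag_reach (Suc (2 * n)) v})"
      by (rule sum_mono) (rule diag_count_step1)
    also have "\<dots> \<le> 2 * (7 * period_count ?P (diag_reach (2 * n) u))"
      unfolding sum_distrib_left[symmetric]
    proof (intro mult_left_mono diag_count_step2)
      fix w x assume "w \<in> preimages u"
      then have "w \<in> sol (Suc (2 * n))" using u by (auto simp: sol_Suc)
      then show "w (x + ?P) = w x" by (rule sol_periodic) (use Suc.prems in simp)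
    qed simp_all
    finally show "(\<Sum>v\<in>preimages u. \<Sum>w\<in>preimages v. period_count ?P (diag_reach (Suc (Suc (2 * n))) w)) \<le>
        14 * period_count ?P (diag_reach (2 * n) u)" by simp
  qed
  also have "\<dots> \<le> 14 * (14 ^ n * (3 * 2 ^ k))"
    unfolding sum_distrib_left[symmetric] using Suc by (intro mult_left_mono) auto
  finally show ?case by simp
qed

text \<open>Positions alone would not contract: an isolated reachable one yields on average 1/2 +
  1/4 + 1/4 positions one step earlier. Edges do contract.\<close>

definition wide_edges :: "nat \<Rightarrow> (int \<Rightarrow> bit) \<Rightarrow> int set" where
  "wide_edges n w = {y. y \<in> wide_reach n w \<or> y + 1 \<in> wide_reach n w}"

text \<open>Each edge of the row \<open>v\<close> is charged for the edges above it, and the two ends of a run of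
  zeros also for the edges by which the run may grow. This adds up to 3 for each edge.\<close>

lemma wide_count_step:
  assumes per: "\<And>w x. w \<in> preimages v \<Longrightarrow> w (x + P) = w x" and "P > 0"
  shows "(\<Sum>w\<in>preimages v. period_count P (wide_edges (Suc n) w)) \<le> 3 * period_count P (wide_edges n v)"
proof -
  let ?G = "wide_reach n v"
  \<comment> \<open>\<open>c\<close> pays for the edge itself; \<open>l\<close> and
    \<open>r\<close>, at the left and right end of a run, pay for the neighbouring edge outside
    it.\<close>
  define c :: "int \<Rightarrow> bit \<Rightarrow> bit \<Rightarrow> nat" where
    "c y a b = of_bool (if y \<in> ?G then if y + 1 \<in> ?G then a = 0 \<or> b = 0 else a = 0
       else y + 1 \<in> ?G \<and> b = 0)" for y a b
  define l :: "int \<Rightarrow> bit \<Rightarrow> bit \<Rightarrow> nat" where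
    "l y a b = of_bool (y \<notin> ?G \<and> y + 1 \<in> ?G \<and> a = 0 \<and> b = 0)" for y a b
  define r :: "int \<Rightarrow> bit \<Rightarrow> bit \<Rightarrow> nat" where
    "r y a b = of_bool (y \<in> ?G \<and> y + 1 \<notin> ?G \<and> a = 0 \<and> b = 0)" for y a b
  have "(\<Sum>w\<in>preimages v. period_count P (wide_edges (Suc n) w)) \<le>
      (\<Sum>w\<in>preimages v. \<Sum>y\<in>{0..<P}. c y (w y) (w (y + 1)) + l y (w y) (w (y + 1)) + r y (w y) (w (y + 1)))"
  proof (rule sum_mono)
    fix w assume w: "w \<in> preimages v"
    then have v: "one3 w = v" by (simp add: preimages_def)
    have G: "y + P \<in> ?G \<longleftrightarrow> y \<in> ?G" for y
      unfolding v[symmetric] by (rule wide_reach_periodic) (rule one3_periodic, rule per[OF w])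
    have per': "w (y + P) = w y" "w (y + P + 1) = w (y + 1)" "y + P + 1 \<in> ?G \<longleftrightarrow> y + 1 \<in> ?G" for y
      using per[OF w, of y] per[OF w, of "y + 1"] G[of "y + 1"] by (simp_all add: algebra_simps)
    define l' where "l' y = l y (w y) (w (y + 1))" for y
    define r' where "r' y = r y (w y) (w (y + 1))" for y
    have "period_count P (wide_edges (Suc n) w) \<le>
        (\<Sum>y\<in>{0..<P}. c y (w y) (w (y + 1)) + l' (y + 1) + r' (y + (- 1)))"
      unfolding period_count_def
    proof (rule sum_mono)
      fix y
      show "of_bool (y \<in> wide_edges (Suc n) w) \<le> c y (w y) (w (y + 1)) + l' (y + 1) + r' (y + (- 1))"
        unfolding wide_edges_def
        by (cases "y - 1 \<in> ?G"; cases "y \<in> ?G"; cases "y + 1 \<in> ?G"; cases "y + 2 \<in> ?G")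
          (simp_all add: c_def l'_def r'_def l_def r_def v add.assoc)
    qed
    also have "\<dots> = (\<Sum>y\<in>{0..<P}. c y (w y) (w (y + 1)) + l' y + r' y)"
      unfolding sum.distrib
      by (subst (1 2) sum_periodic_shift) (use \<open>P > 0\<close> in \<open>simp_all add: l'_def r'_def l_def r_def G per'\<close>)
    finally show "period_count P (wide_edges (Suc n) w) \<le>
        (\<Sum>y\<in>{0..<P}. c y (w y) (w (y + 1)) + l y (w y) (w (y + 1)) + r y (w y) (w (y + 1)))"
      by (simp add: l'_def r'_def)
  qed
  also have "\<dots> = (\<Sum>y\<in>{0..<P}. \<Sum>w\<in>preimages v. c y (w y) (w (y + 1)) + l y (w y) (w (y + 1)) + r y (w y) (w (y + 1)))"
    by (rule sum.swap)
  also have "\<dots> \<le> (\<Sum>y\<in>{0..<P}. 3 * of_bool (y \<in> wide_edges n v))"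
  proof (rule sum_mono)
    fix y
    show "(\<Sum>w\<in>preimages v. c y (w y) (w (y + 1)) + l y (w y) (w (y + 1)) + r y (w y) (w (y + 1))) \<le>
        3 * of_bool (y \<in> wide_edges n v)"
      using sum_preimages_le(1)[of "\<lambda>a b. c y a b + l y a b + r y a b" y v]
      by (cases "y \<in> ?G"; cases "y + 1 \<in> ?G") (simp_all add: c_def l_def r_def wide_edges_def)
  qed
  also have "\<dots> = 3 * period_count P (wide_edges n v)" by (simp add: period_count_def sum_distrib_left)
  finally show ?thesis .
qed

lemma wide_count_sol:
  assumes "n \<le> 2 ^ k"
  shows "(\<Sum>w\<in>sol n. period_count (3 * 2 ^ k) (wide_edges n w)) \<le> 3 ^ n * (3 * 2 ^ k)"
  using assms
proof (induction n)
  case 0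
  then show ?case by (simp add: sol_0 period_count_UNIV wide_edges_def nat_mult_distrib nat_power_eq)
next
  case (Suc n)
  let ?P = "3 * 2 ^ k :: int"
  have "(\<Sum>w\<in>sol (Suc n). period_count ?P (wide_edges (Suc n) w)) \<le>
      (\<Sum>v\<in>sol n. 3 * period_count ?P (wide_edges n v))"
    unfolding sum_sol_Suc
  proof (intro sum_mono wide_count_step)
    fix v w x assume "v \<in> sol n" "w \<in> preimages v"
    then have "w \<in> sol (Suc n)" by (auto simp: sol_Suc)
    then show "w (x + ?P) = w x" by (rule sol_periodic) (use Suc.prems in simp)
  qed simp
  also have "\<dots> \<le> 3 * (3 ^ n * (3 * 2 ^ k))"
    unfolding sum_distrib_left[symmetric] using Suc by (intro mult_left_mono) auto
  finally show ?case by simp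
qed

lemma periodic_nonempty_count:
  assumes "\<And>y. y + P \<in> S \<longleftrightarrow> y \<in> S" "P > 0" "S \<noteq> {}"
  shows "period_count P S \<ge> 1"
proof -
  obtain y where "y \<in> S" using assms(3) by blast
  have "(\<Sum>x\<in>{0..<P}. of_bool (x + y \<in> S)) = period_count P S"
    unfolding period_count_def by (rule sum_periodic_shift) (use assms in auto)
  moreover have "(of_bool (0 + y \<in> S) :: nat) \<le> (\<Sum>x\<in>{0..<P}. of_bool (x + y \<in> S))"
    by (rule member_le_sum) (use \<open>P > 0\<close> in auto)
  ultimately show ?thesis using \<open>y \<in> S\<close> by simp
qed

text \<open>Markov's inequality: an undetermined row has a reachable position and hence counts at
  least 1 in the sum over all solutions.\<close>

lemma card_undetermined:
  assumes f: "web_CA f" "diagonal_compliant f \<or> wide_compliant f" and "k \<ge> 1"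
  shows "card {w\<in>sol (2 ^ k). \<not> determined f (2 ^ k) w} \<le> 14 ^ (2 ^ k div 2) * (3 * 2 ^ k)"
proof -
  define n :: nat where "n = 2 ^ k div 2"
  let ?N = "2 ^ k :: nat" and ?P = "3 * 2 ^ k :: int"
  have n: "?N = 2 * n" using \<open>k \<ge> 1\<close> by (simp add: n_def)
  have P: "w (x + ?P) = w x" if "w \<in> sol ?N" for w x
    using that by (rule sol_periodic) simp
  have *: "card {w\<in>sol ?N. \<not> determined f ?N w} \<le> (\<Sum>w\<in>sol ?N. period_count ?P (S w))"
    if S: "\<And>w. w \<in> sol ?N \<Longrightarrow> \<not> determined f ?N w \<Longrightarrow> period_count ?P (S w) \<ge> 1" for S
  proof -
    have "card {w\<in>sol ?N. \<not> determined f ?N w} = (\<Sum>w\<in>{w\<in>sol ?N. \<not> determined f ?N w}. 1)" by simp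
    also have "\<dots> \<le> (\<Sum>w\<in>{w\<in>sol ?N. \<not> determined f ?N w}. period_count ?P (S w))"
      by (rule sum_mono) (use S in auto)
    also have "\<dots> \<le> (\<Sum>w\<in>sol ?N. period_count ?P (S w))" by (rule sum_mono2) auto
    finally show ?thesis .
  qed
  from f(2) show ?thesis
  proof
    assume diag: "diagonal_compliant f"
    have "card {w\<in>sol ?N. \<not> determined f ?N w} \<le> (\<Sum>w\<in>sol ?N. period_count ?P (diag_reach ?N w))"
    proof (rule *, rule periodic_nonempty_count)
      fix w y assume w: "w \<in> sol ?N" "\<not> determined f ?N w"
      show "y + ?P \<in> diag_reach ?N w \<longleftrightarrow> y \<in> diag_reach ?N w"
        by (rule diag_reach_periodic) (rule P[OF w(1)])
      show "diag_reach ?N w \<noteq> {}"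
        using w(2) diag_reach_if_differ[OF f(1) diag] unfolding determined_def by blast
    qed simp
    also have "\<dots> \<le> 14 ^ n * (3 * 2 ^ k)"
      using diag_count_sol[of n k] by (simp add: n)
    finally show ?thesis by (simp add: n_def)
  next
    assume wide: "wide_compliant f"
    have "card {w\<in>sol ?N. \<not> determined f ?N w} \<le> (\<Sum>w\<in>sol ?N. period_count ?P (wide_edges ?N w))"
    proof (rule *, rule periodic_nonempty_count)
      fix w y assume w: "w \<in> sol ?N" "\<not> determined f ?N w"
      have "y + ?P \<in> wide_reach ?N w \<longleftrightarrow> y \<in> wide_reach ?N w" for y
        by (rule wide_reach_periodic) (rule P[OF w(1)])
      from this[of y] this[of "y + 1"] show "y + ?P \<in> wide_edges ?N w \<longleftrightarrow> y \<in> wide_edges ?N w"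
        by (simp add: wide_edges_def algebra_simps)
      have "wide_reach ?N w \<noteq> {}"
        using w(2) wide_reach_if_differ[OF f(1) wide] unfolding determined_def by blast
      then show "wide_edges ?N w \<noteq> {}" by (auto simp: wide_edges_def)
    qed simp
    also have "\<dots> \<le> 3 ^ ?N * (3 * 2 ^ k)" by (rule wide_count_sol) simp
    \<comment> \<open>Two wide steps multiply by 9 at most, which fits under the diagonal factor 14
      and gives one bound for both cases.\<close>
    also have "(3::nat) ^ ?N = 9 ^ n" unfolding n by (simp add: power_mult)
    also have "\<dots> * (3 * 2 ^ k) \<le> 14 ^ n * (3 * 2 ^ k)" by (intro mult_right_mono power_mono) auto
    finally show ?thesis by (simp add: n_def)
  qed
qed

section \<open>Folding a seed onto the web\<close>

text \<open>The row \<open>2 ^ k\<close> steps above the top of a large void, for the 1 Or 3 rule started from \<open>S\<close>.\<close>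

definition fold_seed :: "nat \<Rightarrow> nat \<Rightarrow> (int \<Rightarrow> bit) \<Rightarrow> int \<Rightarrow> bit" where
  "fold_seed k L S x = (\<Sum>i\<in>{0..int L}. S i * pat (2 ^ k) (x - i))"

lemma one3_pow_convolution:
  "finite I \<Longrightarrow> (one3 ^^ n) (\<lambda>x. \<Sum>i\<in>I. S i * g (x - i)) = (\<lambda>x. \<Sum>i\<in>I. S i * (one3 ^^ n) g (x - i))"
  by (simp add: one3_pow_sum one3_pow_scale one3_pow_shift)

lemma one3_pow_fold_seed:
  "(one3 ^^ n) (fold_seed k L S) = (\<lambda>x. \<Sum>i\<in>{0..int L}. S i * (one3 ^^ n) (pat (2 ^ k)) (x - i))"
proof -
  have "fold_seed k L S = (\<lambda>x. \<Sum>i\<in>{0..int L}. S i * pat (2 ^ k) (x - i))"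
    by (simp add: fold_seed_def fun_eq_iff)
  then show ?thesis by (simp only: one3_pow_convolution finite_atLeastAtMost_int)
qed

lemma fold_seed_in_sol: "fold_seed k L S \<in> sol (2 ^ k)"
proof -
  have "(one3 ^^ (2 ^ k)) (pat (2 ^ k)) x = 0" for x
    unfolding one3_pow2 by (rule pat_rec) simp
  then show ?thesis by (simp add: sol_def one3_pow_fold_seed)
qed

text \<open>The folded rows of all levels up to \<open>k\<close> lie on one 1 Or 3 history, so the
  row at level \<open>k\<close> fixes those of lower level.\<close>

lemma one3_fold_seed_diff:
  "j \<le> k \<Longrightarrow> (one3 ^^ (2 ^ k - 2 ^ j)) (fold_seed k L S) = fold_seed j L S"
  unfolding one3_pow_fold_seed pat_one3_diff by (simp add: fold_seed_def fun_eq_iff)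

lemma fold_seed_add: "fold_seed k L (\<lambda>i. S i + U i) x = fold_seed k L S x + fold_seed k L U x"
  by (simp add: fold_seed_def distrib_right sum.distrib)

lemma pat_small:
  assumes "- N < y" "y < 3 * N"
  shows "pat N y = (if y = N \<or> y = 2 * N then 1 else 0)"
proof (cases "N dvd y")
  case True
  then obtain z where y: "y = N * z" by blast
  have N: "N > 0" using assms by linarith
  have "N * (- 1) < N * z" "N * z < N * 3" using assms unfolding y by linarith+
  then have "- 1 < z" "z < 3"
    using mult_less_cancel_left_pos[OF N, of "- 1" z] mult_less_cancel_left_pos[OF N, of z 3] by blast+
  then have "z = 0 \<or> z = 1 \<or> z = 2" by linarith
  then show ?thesis using N y pat_mult[of N z] by auto
next
  case False
  then show ?thesis by (auto simp: pat_def)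
qed

text \<open>For these \<open>x\<close> and \<open>i\<close> the difference \<open>x - i\<close> lies
  strictly between \<open>- (2 ^ k)\<close> and \<open>3 * 2 ^ k\<close>, where \<open>pat\<close>
  has just two 1s.\<close>

lemma fold_seed_window:
  assumes S: "\<And>i. i < 0 \<or> i \<ge> 2 * 2 ^ k \<Longrightarrow> S i = 0" and L: "2 * 2 ^ k \<le> int L + 1"
    and x: "2 ^ k \<le> x" "x < 3 * 2 ^ k"
  shows "fold_seed k L S x = S (x - 2 ^ k) + S (x - 2 * 2 ^ k)"
proof -
  let ?N = "2 ^ k :: int"
  have N: "?N > 0" by simp
  have "fold_seed k L S x =
      (\<Sum>i\<in>{0..int L}. (if i = x - ?N then S i else 0) + (if i = x - 2 * ?N then S i else 0))"
    unfolding fold_seed_def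
  proof (rule sum.cong)
    fix i assume i: "i \<in> {0..int L}"
    show "S i * pat ?N (x - i) = (if i = x - ?N then S i else 0) + (if i = x - 2 * ?N then S i else 0)"
    proof (cases "i < 2 * ?N")
      case True
      then have "pat ?N (x - i) = (if x - i = ?N \<or> x - i = 2 * ?N then 1 else 0)"
        using i x by (intro pat_small) auto
      then show ?thesis using N by auto
    next
      case False
      then have "S i = 0" using S[of i] by simp
      then show ?thesis by (simp only: mult_zero_left if_cancel add_0_left)
    qed
  qed simp
  also have "\<dots> = S (x - ?N) + S (x - 2 * ?N)"
    using S[of "x - ?N"] S[of "x - 2 * ?N"] x L by (simp add: sum.distrib)
  finally show ?thesis .
qed

text \<open>The inverse of folding for seeds on the first \<open>2 * 2 ^ k\<close> cells. The upper
  half is read from the third block of the window, where the recurrence has cancelled the lower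
  half.\<close>

definition unfold_row :: "nat \<Rightarrow> (int \<Rightarrow> bit) \<Rightarrow> int \<Rightarrow> bit" where
  "unfold_row k v i = (if 0 \<le> i \<and> i < 2 ^ k then v (i + 2 ^ k)
     else if 2 ^ k \<le> i \<and> i < 2 * 2 ^ k then v (i + 2 * 2 ^ k) else 0)"

lemma sol_eqI:
  assumes "v \<in> sol (2 ^ k)" "w \<in> sol (2 ^ k)" "\<And>x. c \<le> x \<Longrightarrow> x < c + 2 * 2 ^ k \<Longrightarrow> v x = w x"
  shows "v = w"
proof -
  have "(\<lambda>x. v x + w x) = (\<lambda>_. 0)"
  proof (rule recurrence_zero_all[where N = "2 ^ k" and c = c])
    fix x
    have "v (x - 2 ^ k) + w (x - 2 ^ k) + (v x + w x) + (v (x + 2 ^ k) + w (x + 2 ^ k)) =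
        (v (x - 2 ^ k) + v x + v (x + 2 ^ k)) + (w (x - 2 ^ k) + w x + w (x + 2 ^ k))"
      by (simp add: algebra_simps)
    also have "\<dots> = 0" by (simp only: sol_rec[OF assms(1)] sol_rec[OF assms(2)] add_0)
    finally show "v (x - 2 ^ k) + w (x - 2 ^ k) + (v x + w x) + (v (x + 2 ^ k) + w (x + 2 ^ k)) = 0" .
  qed (simp_all add: assms(3))
  then have "v x + w x = 0" for x by (rule fun_cong)
  then show ?thesis by (intro ext) (rule bit_eq_if_add_zero)
qed

lemma sol_step: "v \<in> sol (2 ^ k) \<Longrightarrow> v (x + 2 ^ k) = v x + v (x - 2 ^ k)"
  using sol_rec[of v k x] by (cases "v x"; cases "v (x - 2 ^ k)"; cases "v (x + 2 ^ k)") simp_all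

lemma fold_unfold:
  assumes v: "v \<in> sol (2 ^ k)" and L: "2 * 2 ^ k \<le> int L + 1"
  shows "fold_seed k L (unfold_row k v) = v"
proof (rule sol_eqI[OF fold_seed_in_sol v, where c = "2 ^ k"])
  fix x :: int assume x: "2 ^ k \<le> x" "x < 2 ^ k + 2 * 2 ^ k"
  have "fold_seed k L (unfold_row k v) x = unfold_row k v (x - 2 ^ k) + unfold_row k v (x - 2 * 2 ^ k)"
    by (rule fold_seed_window) (use x L in \<open>auto simp: unfold_row_def\<close>)
  also have "\<dots> = v x"
  proof (cases "x < 2 * 2 ^ k")
    case True
    then show ?thesis using x by (simp add: unfold_row_def)
  next
    case False
    then have "unfold_row k v (x - 2 ^ k) + unfold_row k v (x - 2 * 2 ^ k) = v (x + 2 ^ k) + v (x - 2 ^ k)"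
      using x by (simp add: unfold_row_def algebra_simps)
    also have "\<dots> = v x" unfolding sol_step[OF v] by (simp add: algebra_simps)
    finally show ?thesis .
  qed
  finally show "fold_seed k L (unfold_row k v) x = v x" .
qed

lemma unfold_fold:
  assumes S: "\<And>i. i < 0 \<or> i \<ge> 2 * 2 ^ k \<Longrightarrow> S i = 0" and L: "2 * 2 ^ k \<le> int L + 1"
  shows "unfold_row k (fold_seed k L S) = S"
proof
  fix i
  let ?N = "2 ^ k :: int" and ?F = "fold_seed k L S"
  have F: "?F x = S (x - ?N) + S (x - 2 * ?N)" if "?N \<le> x" "x < 3 * ?N" for x
    using S L that by (rule fold_seed_window)
  consider "0 \<le> i" "i < ?N" | "?N \<le> i" "i < 2 * ?N" | "i < 0 \<or> i \<ge> 2 * ?N" by linarith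
  then show "unfold_row k ?F i = S i"
  proof cases
    case 1
    then have "unfold_row k ?F i = ?F (i + ?N)" by (simp add: unfold_row_def)
    also have "\<dots> = S i + S (i - ?N)" using F[of "i + ?N"] 1 by simp
    finally show ?thesis using S[of "i - ?N"] 1 by simp
  next
    case 2
    then have "unfold_row k ?F i = ?F (i + 2 * ?N)" by (simp add: unfold_row_def)
    also have "\<dots> = ?F (i + ?N) + ?F i"
      using sol_step[OF fold_seed_in_sol, of k L S "i + ?N"] by (simp add: algebra_simps)
    also have "?F (i + ?N) = S i + S (i - ?N)" using F[of "i + ?N"] 2 by simp
    also have "?F i = S (i - ?N) + S (i - 2 * ?N)" using F[of i] 2 by simp
    finally show ?thesis using S[of "i - 2 * ?N"] 2 by (simp add: algebra_simps)
  next
    case 3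
    then have "\<not> (0 \<le> i \<and> i < ?N)" "\<not> (?N \<le> i \<and> i < 2 * ?N)"
      using zero_less_power[of "2 :: int" k] by linarith+
    then show ?thesis using S[OF 3] by (simp only: unfold_row_def if_False)
  qed
qed

definition bit_seeds :: "nat \<Rightarrow> (int \<Rightarrow> bit) set" where
  "bit_seeds L = {S. \<forall>x. x \<notin> {0..int L} \<longrightarrow> S x = 0}"

text \<open>Folding is linear, and it is a bijection from the seeds on the first
  \<open>2 * 2 ^ k\<close> cells onto the solutions. Each choice of the remaining cells therefore
  meets every solution exactly once, so the folded row is uniform.\<close>

lemma card_fold_seed:
  assumes L: "2 * 2 ^ k \<le> int L + 1" and B: "B \<subseteq> sol (2 ^ k)"
  shows "card {S\<in>bit_seeds L. fold_seed k L S \<in> B} =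
    card B * card {U\<in>bit_seeds L. \<forall>x<2 * 2 ^ k. U x = 0}"
proof -
  let ?H = "{U\<in>bit_seeds L. \<forall>x<2 * 2 ^ k. U x = 0}" and ?N = "2 ^ k :: int"
  let ?up = "\<lambda>S i. if i < 2 * ?N then 0 else S i :: bit"
  let ?\<phi> = "fold_seed k L"
  \<comment> \<open>The far part \<open>U\<close> is free; the near part is chosen so that its fold
    turns the fold of \<open>U\<close> into \<open>v\<close>.\<close>
  let ?f = "\<lambda>(v, U) i. unfold_row k (\<lambda>x. v x + ?\<phi> U x) i + U i"
  let ?g = "\<lambda>S. (?\<phi> S, ?up S)"
  have low: "unfold_row k v i = 0" if "i < 0 \<or> i \<ge> 2 * ?N" for v i
    using that zero_less_power[of "2 :: int" k] unfolding unfold_row_def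
    by (auto simp del: zero_less_power)
  have sum_sol: "(\<lambda>x. v x + w x) \<in> sol (2 ^ k)" if "v \<in> sol (2 ^ k)" "w \<in> sol (2 ^ k)" for v w
    using that by (simp add: sol_def one3_pow_add)
  have \<phi>f: "?\<phi> (?f (v, U)) = v" if "v \<in> sol (2 ^ k)" for v U
  proof
    fix x
    have "?\<phi> (?f (v, U)) x = ?\<phi> (unfold_row k (\<lambda>x. v x + ?\<phi> U x)) x + ?\<phi> U x"
      by (simp add: fold_seed_add)
    also have "\<dots> = v x + ?\<phi> U x + ?\<phi> U x"
      by (subst fold_unfold[OF sum_sol[OF that fold_seed_in_sol] L]) simp
    finally show "?\<phi> (?f (v, U)) x = v x" by (simp add: add.assoc)
  qed
  have "bij_betw ?f (B \<times> ?H) {S\<in>bit_seeds L. ?\<phi> S \<in> B}"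
  proof (rule bij_betw_byWitness[where f' = ?g])
    show "\<forall>p\<in>B \<times> ?H. ?g (?f p) = p"
    proof
      fix p assume "p \<in> B \<times> ?H"
      then obtain v U where p: "p = (v, U)" "v \<in> B" "U \<in> ?H" by blast
      have "?up (?f (v, U)) = U"
      proof
        fix i show "?up (?f (v, U)) i = U i" using p low[of i] by auto
      qed
      moreover have "?\<phi> (?f (v, U)) = v" using \<phi>f p(2) B by blast
      ultimately show "?g (?f p) = p" unfolding p(1) by (simp only:)
    qed
    show "\<forall>S\<in>{S\<in>bit_seeds L. ?\<phi> S \<in> B}. ?f (?g S) = S"
    proof
      fix S assume "S \<in> {S\<in>bit_seeds L. ?\<phi> S \<in> B}"
      then have S: "S \<in> bit_seeds L" by simp
      let ?l = "\<lambda>i. if i < 2 * ?N then S i else 0"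
      have split: "S = (\<lambda>i. ?l i + ?up S i)" by auto
      have "(\<lambda>x. ?\<phi> S x + ?\<phi> (?up S) x) = ?\<phi> ?l"
      proof
        fix x
        have "?\<phi> S x = ?\<phi> ?l x + ?\<phi> (?up S) x"
          by (subst split) (rule fold_seed_add)
        then show "?\<phi> S x + ?\<phi> (?up S) x = ?\<phi> ?l x" by (simp add: add.assoc)
      qed
      moreover have "unfold_row k (?\<phi> ?l) = ?l"
        by (rule unfold_fold[OF _ L]) (use S in \<open>auto simp: bit_seeds_def\<close>)
      ultimately show "?f (?g S) = S" by auto
    qed
    show "?f ` (B \<times> ?H) \<subseteq> {S\<in>bit_seeds L. ?\<phi> S \<in> B}"
    proof
      fix S assume "S \<in> ?f ` (B \<times> ?H)"
      then obtain v U where p: "S = ?f (v, U)" "v \<in> B" "U \<in> ?H" by blast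
      have "?\<phi> S = v" unfolding p(1) using \<phi>f p(2) B by blast
      moreover have "S \<in> bit_seeds L"
        using p(3) low L unfolding p(1) by (auto simp: bit_seeds_def)
      ultimately show "S \<in> {S\<in>bit_seeds L. ?\<phi> S \<in> B}" using p(2) by simp
    qed
    show "?g ` {S\<in>bit_seeds L. ?\<phi> S \<in> B} \<subseteq> B \<times> ?H"
      by (auto simp: bit_seeds_def)
  qed
  then show ?thesis by (simp add: bij_betw_same_card[symmetric] card_cartesian_product)
qed

section \<open>The law of the folded row of a random seed\<close>

lemma bit_seeds_PiE_dflt: "bit_seeds L = PiE_dflt {0..int L} 0 (\<lambda>_. {0, 1})"
  by (auto simp: bit_seeds_def PiE_dflt_def)

lemma card_bit_seeds: "card (bit_seeds L) = 2 ^ (L + 1)"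
  by (simp add: bit_seeds_PiE_dflt card_PiE_dflt nat_add_distrib numeral_2_eq_2)

lemma finite_bit_seeds [simp]: "finite (bit_seeds L)"
  unfolding bit_seeds_PiE_dflt by (rule finite_PiE_dflt) auto

text \<open>Choose \<open>L\<close> so that the seed has exactly \<open>2 * 2 ^ k\<close> cells:
  then no free cells remain, and folding is a bijection onto the solutions.\<close>

lemma card_sol: "card (sol (2 ^ k)) = 4 ^ (2 ^ k)"
proof -
  define L :: nat where "L = 2 * 2 ^ k - 1"
  have L: "L + 1 = 2 * 2 ^ k" by (simp add: L_def)
  then have L': "int L + 1 = 2 * 2 ^ k" by (metis of_nat_1 of_nat_add of_nat_mult of_nat_numeral of_nat_power)
  have "{U\<in>bit_seeds L. \<forall>x<2 * 2 ^ k. U x = 0} = {\<lambda>_. 0}"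
  proof (intro equalityI subsetI)
    fix U assume "U \<in> {U\<in>bit_seeds L. \<forall>x<2 * 2 ^ k. U x = 0}"
    then have "U x = 0" for x using L' by (cases "x < 2 * 2 ^ k") (auto simp: bit_seeds_def)
    then show "U \<in> {\<lambda>_. 0}" by auto
  qed (auto simp: bit_seeds_def)
  then have "card (sol (2 ^ k)) = card {S\<in>bit_seeds L. fold_seed k L S \<in> sol (2 ^ k)}"
    using card_fold_seed[of k L "sol (2 ^ k)"] L' by simp
  also have "\<dots> = 2 ^ (2 * 2 ^ k)"
    using card_bit_seeds[of L] unfolding L by (simp add: fold_seed_in_sol)
  finally show ?thesis by (simp add: power_mult)
qed

lemma random_seed_eq: "random_seed L = pmf_of_set (binary_seeds_on L)"
proof -
  have "binary_seeds_on L = PiE_dflt {0..int L} S0 (\<lambda>_. {S0, S1})"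
    by (auto simp: binary_seeds_on_def PiE_dflt_def)
  then show ?thesis unfolding random_seed_def by (simp add: Pi_pmf_of_set)
qed

lemma bij_bit_seeds:
  "bij_betw (\<lambda>\<xi> x. bit_of (\<xi> x)) (binary_seeds_on L) (bit_seeds L)"
proof (rule bij_betw_byWitness[where f' = "\<lambda>S x. if S x = 1 then S1 else S0"])
  show "\<forall>\<xi>\<in>binary_seeds_on L. (\<lambda>x. if bit_of (\<xi> x) = 1 then S1 else S0) = \<xi>"
  proof
    fix \<xi> assume "\<xi> \<in> binary_seeds_on L"
    then have "\<xi> x = S0 \<or> \<xi> x = S1" for x by (auto simp: binary_seeds_on_def)
    then have "(if bit_of (\<xi> x) = 1 then S1 else S0) = \<xi> x" for x
      using bit_of_simps by (metis zero_neq_one)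
    then show "(\<lambda>x. if bit_of (\<xi> x) = 1 then S1 else S0) = \<xi>" by simp
  qed
  show "\<forall>S\<in>bit_seeds L. (\<lambda>x. bit_of (if S x = 1 then S1 else S0)) = S"
    by (auto simp: fun_eq_iff)
qed (auto simp: binary_seeds_on_def bit_seeds_def split: if_splits)

lemma finite_binary_seeds: "finite (binary_seeds_on L)"
  using bij_betw_finite[OF bij_bit_seeds] by simp

lemma binary_seeds_nonempty: "binary_seeds_on L \<noteq> {}"
  by (auto simp: binary_seeds_on_def intro!: exI[of _ "\<lambda>_. S0"])

definition web_row :: "nat \<Rightarrow> nat \<Rightarrow> (int \<Rightarrow> state) \<Rightarrow> int \<Rightarrow> bit" where
  "web_row k L \<xi> = fold_seed k L (\<lambda>x. bit_of (\<xi> x))"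

lemma prob_web_row:
  assumes L: "2 * 2 ^ k \<le> int L + 1" and B: "B \<subseteq> sol (2 ^ k)"
  shows "measure_pmf.prob (random_seed L) {\<xi>. web_row k L \<xi> \<in> B} = card B / 4 ^ (2 ^ k)"
proof -
  let ?h = "\<lambda>\<xi> x. bit_of (\<xi> x)" and ?H = "{U\<in>bit_seeds L. \<forall>x<2 * 2 ^ k. U x = 0}"
  have "card (binary_seeds_on L) = 2 ^ (L + 1)"
    using bij_betw_same_card[OF bij_bit_seeds] by (simp add: card_bit_seeds)
  also have "\<dots> = card (sol (2 ^ k)) * card ?H"
    using card_fold_seed[OF L, of "sol (2 ^ k)"] by (simp add: fold_seed_in_sol card_bit_seeds)
  finally have all: "card (binary_seeds_on L) = 4 ^ (2 ^ k) * card ?H" by (simp only: card_sol)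
  have "binary_seeds_on L \<inter> {\<xi>. web_row k L \<xi> \<in> B} = {\<xi>\<in>binary_seeds_on L. fold_seed k L (?h \<xi>) \<in> B}"
    by (auto simp: web_row_def)
  moreover have "bij_betw ?h \<dots> {S\<in>bit_seeds L. fold_seed k L S \<in> B}"
    using bij_bit_seeds[of L] by (auto simp: bij_betw_def inj_on_def)
  ultimately have "card (binary_seeds_on L \<inter> {\<xi>. web_row k L \<xi> \<in> B}) = card B * card ?H"
    using card_fold_seed[OF L B] by (simp add: bij_betw_same_card)
  moreover have "card ?H \<noteq> 0"
    using all binary_seeds_nonempty[of L] finite_binary_seeds[of L]
    by (metis card_eq_0_iff mult_0_right)
  ultimately show ?thesis
    unfolding random_seed_eq
    by (subst measure_pmf_of_set) (simp_all add: binary_seeds_nonempty finite_binary_seeds all)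
qed

section \<open>Filling the voids\<close>

lemma evolve_bit_of_pulse:
  assumes f: "web_CA f" and seed: "\<And>x. x \<notin> {0..int L} \<Longrightarrow> bit_of (\<xi> x) = 0"
  shows "bit_of (evolve f \<xi> t x) = (\<Sum>i\<in>{0..int L}. bit_of (\<xi> i) * pulse t (x - i))"
proof -
  have row: "(\<lambda>x. bit_of (\<xi> x)) = (\<lambda>x. \<Sum>i\<in>{0..int L}. bit_of (\<xi> i) * (if x - i = 0 then 1 else 0))"
  proof
    fix x
    have "(\<Sum>i\<in>{0..int L}. bit_of (\<xi> i) * (if x - i = 0 then 1 else 0)) =
        (\<Sum>i\<in>{0..int L}. if i = x then bit_of (\<xi> i) else 0)"
      by (rule sum.cong) auto
    also have "\<dots> = bit_of (\<xi> x)" using seed[of x] by simp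
    finally show "bit_of (\<xi> x) = (\<Sum>i\<in>{0..int L}. bit_of (\<xi> i) * (if x - i = 0 then 1 else 0))" ..
  qed
  have "(one3 ^^ t) (\<lambda>x. bit_of (\<xi> x)) = (\<lambda>x. \<Sum>i\<in>{0..int L}. bit_of (\<xi> i) * pulse t (x - i))"
    unfolding pulse_def by (subst row, rule one3_pow_convolution[where g = "\<lambda>y. if y = 0 then 1 else 0"]) simp
  then show ?thesis by (simp add: evolve_bit_of[OF f])
qed

definition state_row :: "(int \<Rightarrow> bit) \<Rightarrow> int \<Rightarrow> state" where
  "state_row w x = (if w x = 1 then S1 else S0)"

lemma bit_of_state_row [simp]: "bit_of (state_row w x) = w x"
  by (cases "w x") (simp_all add: state_row_def)

text \<open>By superposition the web \<open>2 ^ k\<close> steps above the void is a translate of the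
  folded row, with a loss of \<open>L\<close> on the left. Determination removes the dependence on
  2s at the top of the void. From then on the outer inputs of the rule count only through the web,
  which is 0, so influence travels at speed 1, no faster than the sides close in.\<close>

lemma void_states:
  assumes f: "web_CA f" "empty_compliant f"
    and seed: "\<And>x. x \<notin> {0..int L} \<Longrightarrow> bit_of (\<xi> x) = 0"
    and det: "determined f (2 ^ k) (web_row k L \<xi>)"
    and v: "void t p q" and size: "q - p \<ge> 6 * 2 ^ k"
  shows "\<exists>a. \<forall>n x. p + 2 ^ k + int L + int n \<le> x \<longrightarrow> x \<le> q - 2 ^ k - int n \<longrightarrow>
    evolve f \<xi> (t + n) x = evolve f (state_row (web_row k L \<xi>)) (2 ^ k + n) (x - a)"
proof -
  define N :: nat where "N = 2 ^ k"
  define w where "w = web_row k L \<xi>"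
  have iN: "(2 ^ k :: int) = int N" and N1: "N \<ge> 1" by (simp_all add: N_def)
  have w_sol: "w \<in> sol N" unfolding w_def web_row_def N_def by (rule fold_seed_in_sol)
  from large_void[OF v size] obtain a where tN: "N \<le> t"
    and a: "\<And>x. p - int N \<le> x \<Longrightarrow> x \<le> q + int N \<Longrightarrow> pulse (t - N) x = pat (int N) (x - a)"
    unfolding iN N_def[symmetric] by auto
  have bits: "bit_of (evolve f \<xi> (t - N) x) = w (x - a)"
    if "p - int N + int L \<le> x" "x \<le> q + int N" for x
  proof -
    have "bit_of (evolve f \<xi> (t - N) x) = (\<Sum>i\<in>{0..int L}. bit_of (\<xi> i) * pulse (t - N) (x - i))"
      by (rule evolve_bit_of_pulse[OF f(1) seed])
    also have "\<dots> = (\<Sum>i\<in>{0..int L}. bit_of (\<xi> i) * pat (int N) (x - a - i))"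
    proof (rule sum.cong)
      fix i assume "i \<in> {0..int L}"
      then have "pulse (t - N) (x - i) = pat (int N) (x - i - a)" using that by (intro a) auto
      then show "bit_of (\<xi> i) * pulse (t - N) (x - i) = bit_of (\<xi> i) * pat (int N) (x - a - i)"
        by (simp add: algebra_simps)
    qed simp
    also have "\<dots> = w (x - a)" by (simp add: w_def web_row_def fold_seed_def iN)
    finally show ?thesis .
  qed
  \<comment> \<open>The actual states where the web is known, continued by the reference row so that
    determination, a statement about bi-infinite rows, applies.\<close>
  define \<zeta> where "\<zeta> y = (if p - int N + int L \<le> y + a \<and> y + a \<le> q + int N
      then evolve f \<xi> (t - N) (y + a) else state_row w y)" for y
  have "(\<lambda>x. bit_of (\<zeta> x)) = w"
    using bits by (auto simp: \<zeta>_def fun_eq_iff)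
  then have same: "evolve f \<zeta> N = evolve f (state_row w) N"
    using det[folded N_def w_def, unfolded determined_def, rule_format, of \<zeta> "state_row w"]
    by (simp only: bit_of_state_row simp_thms)
  have "evolve f \<xi> (t + n) x = evolve f (state_row w) (N + n) (x - a)"
    if "p + int N + int L + int n \<le> x" "x \<le> q - int N - int n" for n x
    using that
  proof (induction n arbitrary: x)
    case 0
    have "evolve f \<xi> (t + 0) x = evolve f (evolve f \<xi> (t - N)) N x"
      using tN by (simp flip: evolve_add)
    also have "\<dots> = evolve f (\<lambda>y. evolve f \<xi> (t - N) (y + a)) N (x - a)"
      by (simp add: evolve_shift)
    also have "\<dots> = evolve f \<zeta> N (x - a)"
      by (rule evolve_local) (use 0 in \<open>auto simp: \<zeta>_def\<close>)
    finally show ?case by (simp add: same)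
  next
    case (Suc n)
    let ?u = "evolve f \<xi> (t + n)" and ?v = "\<lambda>y. evolve f (state_row w) (N + n) (y - a)"
    have eq: "?u y = ?v y" if "y \<in> {x - 1, x, x + 1}" for y
      by (rule Suc.IH) (use that Suc.prems in auto)
    \<comment> \<open>The cells at distance 2 may leave the region of the induction hypothesis, but
      they remain inside the triangle of zeros.\<close>
    have far: "bit_of (?u y) = bit_of (?v y)" if "y \<in> {x - 2, x + 2}" for y
    proof -
      have "(one3 ^^ (N + n)) w = (\<lambda>_. 0)"
        using w_sol sol_mono[of N "N + n"] by (auto simp: sol_def)
      then have "bit_of (?v y) = 0" by (simp add: evolve_bit_of[OF f(1)])
      moreover have "pulse (t + n) (y - i) = 0" if "i \<in> {0..int L}" for i
        by (rule void_triangle_zero[OF v]) (use that \<open>y \<in> _\<close> Suc.prems N1 in auto)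
      then have "(\<Sum>i\<in>{0..int L}. bit_of (\<xi> i) * pulse (t + n) (y - i)) = 0"
        by (intro sum.neutral) (simp del: atLeastAtMost_iff)
      moreover have "bit_of (?u y) = (\<Sum>i\<in>{0..int L}. bit_of (\<xi> i) * pulse (t + n) (y - i))"
        by (rule evolve_bit_of_pulse[OF f(1) seed])
      ultimately show ?thesis by simp
    qed
    have "evolve f \<xi> (t + Suc n) x = f (?u (x - 2)) (?u (x - 1)) (?u x) (?u (x + 1)) (?u (x + 2))"
      by simp
    also have "\<dots> = f (?v (x - 2)) (?v (x - 1)) (?v x) (?v (x + 1)) (?v (x + 2))"
    proof -
      have e: "?u (x - 1) = ?v (x - 1)" "?u x = ?v x" "?u (x + 1) = ?v (x + 1)"
        by (rule eq, simp)+
      show ?thesis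
        unfolding e by (rule f(2)[unfolded empty_compliant_def delta_eq_iff, rule_format]) (rule far, simp)+
    qed
    also have "\<dots> = evolve f (state_row w) (N + Suc n) (x - a)"
      by (simp add: algebra_simps)
    finally show ?case .
  qed
  then show ?thesis unfolding iN N_def[symmetric] w_def[symmetric] by blast
qed

section \<open>Ethers from periodic rows\<close>

lemma finite_periodic_rows:
  assumes "P > 0"
  shows "finite {r :: int \<Rightarrow> state. \<forall>x. r (x + P) = r x}"
proof (rule finite_subset)
  show "{r. \<forall>x. r (x + P) = r x} \<subseteq> (\<lambda>g x. g (x mod P)) ` PiE {0..<P} (\<lambda>_. {S0, S1, S2})"
  proof
    fix r :: "int \<Rightarrow> state" assume "r \<in> {r. \<forall>x. r (x + P) = r x}"
    then have "r (x mod P) = r x" for x by (intro periodic_mod) simp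
    then have "r = (\<lambda>x. restrict r {0..<P} (x mod P))" using assms by (simp add: fun_eq_iff)
    moreover have "restrict r {0..<P} \<in> PiE {0..<P} (\<lambda>_. {S0, S1, S2})"
      using state.exhaust by (auto simp: PiE_def)
    ultimately show "r \<in> (\<lambda>g x. g (x mod P)) ` PiE {0..<P} (\<lambda>_. {S0, S1, S2})" by blast
  qed
qed (auto intro: finite_PiE)

text \<open>There are finitely many rows of a given spatial period, so two rows of the evolution
  coincide, and it repeats from then on.\<close>

lemma eventually_ether:
  assumes f: "web_CA f" and w: "w \<in> sol (2 ^ k)"
  shows "\<exists>\<eta> j. ether \<eta> \<and> (\<forall>t\<ge>j. \<forall>x. \<eta> (x, int t) = evolve f (state_row w) t x)"
proof -
  define N :: nat where "N = 2 ^ k"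
  define P :: int where "P = 3 * 2 ^ k"
  define r where "r = evolve f (state_row w)"
  have "P > 0" by (simp add: P_def)
  have shift: "(\<lambda>x. state_row w (x + P)) = state_row w"
    using sol_periodic[OF w, of k] by (simp add: state_row_def P_def fun_eq_iff)
  have per: "r t (x + P) = r t x" for t x
    using evolve_shift[of f "state_row w" P t x] by (simp add: shift r_def)
  have "finite (range (\<lambda>i. r (N + i)))"
    by (rule finite_subset[OF _ finite_periodic_rows[OF \<open>P > 0\<close>]]) (auto simp: per)
  then have "\<not> inj (\<lambda>i. r (N + i))" using finite_imageD infinite_UNIV_nat by blast
  then obtain i j where "i < j" and ij: "r (N + i) = r (N + j)"
    unfolding inj_def by (metis nat_neq_iff)
  \<comment> \<open>Starting at \<open>N\<close> or later ensures that the web has died, so only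
    \<open>S0\<close> and \<open>S2\<close> occur in the repeated rows.\<close>
  define s T where "s = N + i" and "T = j - i"
  have T: "T > 0" "r (s + T) = r s" using \<open>i < j\<close> ij by (auto simp: s_def T_def)
  have step: "r (s + m + T) = r (s + m)" for m
  proof -
    have "r (s + m + T) = evolve f (r (s + T)) m"
      unfolding r_def evolve_add[symmetric] by (simp add: ac_simps)
    also have "\<dots> = r (s + m)" unfolding T(2) by (simp add: r_def evolve_add)
    finally show ?thesis .
  qed
  have steps: "r (s + m + q * T) = r (s + m)" for m q
  proof (induction q)
    case (Suc q)
    then show ?case using step[of "m + q * T"] by (simp add: ac_simps)
  qed simp
  \<comment> \<open>The repeating block is extended to all integer times, including negative
    ones.\<close>
  define \<eta> where "\<eta> = (\<lambda>(x, t). r (s + nat ((t - int s) mod int T)) x)"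
  have "\<eta> (x, int t) = r t x" if "t \<ge> s" for t x
  proof -
    have "(int t - int s) mod int T = int ((t - s) mod T)" using that by (simp add: zmod_int of_nat_diff)
    then have "\<eta> (x, int t) = r (s + (t - s) mod T) x" by (simp add: \<eta>_def)
    moreover have "s + (t - s) mod T + (t - s) div T * T = t" using that by (simp add: add.assoc)
    ultimately show ?thesis using steps[of "(t - s) mod T" "(t - s) div T"] by simp
  qed
  moreover have "ether \<eta>"
    unfolding ether_def
  proof (intro conjI allI)
    fix p :: "int \<times> int"
    obtain x t where p: "p = (x, t)" by (cases p)
    define m where "m = s + nat ((t - int s) mod int T)"
    have "w \<in> sol m" using w sol_mono[of "2 ^ k" m] by (auto simp: m_def s_def N_def)
    then have "bit_of (r m x) = 0" by (simp add: r_def evolve_bit_of[OF f] sol_def)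
    then have "r m x \<noteq> S1" by (auto simp: bit_of_def)
    then show "\<eta> p \<in> {S0, S2}" unfolding p \<eta>_def m_def[symmetric] by (cases "r m x") (auto simp: m_def)
  next
    show "\<exists>m>0. \<forall>x t. \<eta> (x + m, t) = \<eta> (x, t)"
      by (intro exI[of _ P]) (simp add: \<eta>_def per \<open>P > 0\<close>)
    show "\<exists>n>0. \<forall>x t. \<eta> (x, t + n) = \<eta> (x, t)"
    proof (intro exI[of _ "int T"] conjI allI)
      fix x t :: int
      have "(t + int T - int s) mod int T = (t - int s) mod int T"
        using mod_add_self2[of "t - int s" "int T"] by (simp add: algebra_simps)
      then show "\<eta> (x, t + int T) = \<eta> (x, t)" by (simp add: \<eta>_def)
    qed (use T in simp)
  qed
  ultimately show ?thesis unfolding r_def by blast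
qed

section \<open>Bounded components outside the thickened pattern\<close>

lemma not_Lambda_nbhd:
  assumes "(x, t) \<notin> \<Lambda>_nbhd r" "real_of_int (\<bar>x - x'\<bar> + \<bar>t - t'\<bar>) \<le> r" "t' \<ge> 0"
  shows "pulse (nat t') x' = 0"
proof (rule ccontr)
  assume "pulse (nat t') x' \<noteq> 0"
  then have "(x', t') \<in> \<Lambda>" using assms(3) by (simp add: Lambda_iff)
  then show False using assms(1,2) by (auto simp: \<Lambda>_nbhd_def l1_dist_def)
qed

lemma not_Lambda_nbhd_far:
  assumes "(x, t) \<notin> \<Lambda>_nbhd r" "pulse m x' = 1"
  shows "r < real_of_int (\<bar>x - x'\<bar> + \<bar>t - int m\<bar>)"
  using not_Lambda_nbhd[OF assms(1), of x' "int m"] assms(2) by fastforce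

text \<open>Outside the cone the distance to an edge point of the pattern is
  \<open>\<bar>x\<bar> - t\<close>, a lower bound for the distance to every point of \<Lambda>; it
  does not decrease on moving outwards.\<close>

lemma outside_cone_far:
  assumes p: "(x, t) \<notin> \<Lambda>_nbhd r" and "\<bar>x\<bar> > t"
    and y: "\<bar>y\<bar> \<ge> \<bar>x\<bar>"
  shows "(y, t) \<notin> \<Lambda>_nbhd r"
proof
  assume "(y, t) \<in> \<Lambda>_nbhd r"
  then obtain x' t' where q: "(x', t') \<in> \<Lambda>" "real_of_int (\<bar>y - x'\<bar> + \<bar>t - t'\<bar>) \<le> r"
    by (auto simp: \<Lambda>_nbhd_def l1_dist_def)
  then have "\<bar>x'\<bar> \<le> t'"
    using pulse_outside[of "nat t'" x'] by (fastforce simp: Lambda_iff)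
  then have 1: "\<bar>x\<bar> - t \<le> \<bar>y - x'\<bar> + \<bar>t - t'\<bar>" using y by linarith
  \<comment> \<open>The edge points at time \<open>t\<close>, or the origin if \<open>t\<close> is
    negative.\<close>
  define u where "u = nat (max t 0)"
  have "r < real_of_int (\<bar>x - int u\<bar> + \<bar>t - int u\<bar>)" "r < real_of_int (\<bar>x - - int u\<bar> + \<bar>t - int u\<bar>)"
    by (rule not_Lambda_nbhd_far[OF p], rule pulse_edges)+
  moreover have "\<bar>x - int u\<bar> + \<bar>t - int u\<bar> = \<bar>x\<bar> - t \<or> \<bar>x - - int u\<bar> + \<bar>t - int u\<bar> = \<bar>x\<bar> - t"
    using \<open>\<bar>x\<bar> > t\<close> by (auto simp: u_def)
  ultimately have "r < real_of_int (\<bar>x\<bar> - t)" by auto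
  also have "\<dots> \<le> r" using 1 q(2) by linarith
  finally show False by simp
qed

lemma outside_cone_infinite:
  assumes p: "(x, t) \<notin> \<Lambda>_nbhd r" and "\<bar>x\<bar> > t"
  shows "infinite (lattice_component (- \<Lambda>_nbhd r) (x, t))"
proof -
  define s :: int where "s = (if x \<ge> 0 then 1 else - 1)"
  let ?R = "{(u, v). u \<in> - \<Lambda>_nbhd r \<and> v \<in> - \<Lambda>_nbhd r \<and> l1_dist u v = 1}"
  have off: "(x + s * int i, t) \<notin> \<Lambda>_nbhd r" for i
    by (rule outside_cone_far[OF assms]) (auto simp: s_def)
  have "((x, t), (x + s * int i, t)) \<in> ?R\<^sup>*" for i
  proof (induction i)
    case (Suc i)
    have "((x + s * int i, t), (x + s * int (Suc i), t)) \<in> ?R"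
      using off[of i] off[of "Suc i"] by (auto simp: l1_dist_def s_def)
    with Suc show ?case by (rule rtrancl_into_rtrancl)
  qed simp
  then have "range (\<lambda>i. (x + s * int i, t)) \<subseteq> lattice_component (- \<Lambda>_nbhd r) (x, t)"
    by (auto simp: lattice_component_def)
  moreover have "inj (\<lambda>i. (x + s * int i, t))" by (auto simp: inj_def s_def)
  ultimately show ?thesis using finite_subset range_inj_infinite by blast
qed

definition void_triangle :: "nat \<Rightarrow> int \<Rightarrow> int \<Rightarrow> (int \<times> int) set" where
  "void_triangle t p q = {(x, int (t + n)) | x n. p + int n \<le> x \<and> x \<le> q - int n}"

text \<open>To leave the triangle a path must pass close to a 1: the sides are lined with 1s by
  \<open>void_triangle_boundary\<close>, and above the top every cell is a 1 or has a 1 beside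
  it.\<close>

lemma void_triangle_step:
  assumes v: "void t0 p q" and "r \<ge> 2"
    and a: "(x, t) \<in> void_triangle t0 p q" "(x, t) \<notin> \<Lambda>_nbhd r"
    and b: "(y, s) \<notin> \<Lambda>_nbhd r" "\<bar>x - y\<bar> + \<bar>t - s\<bar> = 1"
  shows "(y, s) \<in> void_triangle t0 p q"
proof -
  from a(1) obtain n where n: "t = int (t0 + n)" "p + int n \<le> x" "x \<le> q - int n"
    by (auto simp: void_triangle_def)
  have bd: "pulse (t0 + n) (p + int n - 1) = 1" "pulse (t0 + n) (q - int n + 1) = 1"
    using void_triangle_boundary[OF v, of n] n by auto
  note far = not_Lambda_nbhd_far[OF a(2) bd(1)] not_Lambda_nbhd_far[OF a(2) bd(2)]
  have x: "p + int n + 1 < x" "x < q - int n - 1"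
    using far n \<open>r \<ge> 2\<close> by auto
  consider "s = t" "\<bar>x - y\<bar> = 1" | "s = t + 1" "y = x" | "s = t - 1" "y = x" using b(2) by linarith
  then show ?thesis
  proof cases
    case 1
    then show ?thesis using n x unfolding void_triangle_def by auto
  next
    case 2
    then show ?thesis using n x unfolding void_triangle_def
      by (intro CollectI exI[of _ y] exI[of _ "Suc n"]) auto
  next
    case 3
    show ?thesis
    proof (cases n)
      case 0
      have "t0 \<ge> 1" using v by (simp add: void_def)
      have s: "s = int (t0 - 1)" using 3 n 0 \<open>t0 \<ge> 1\<close> by auto
      have "pulse (t0 - 1) x = 1 \<or> pulse (t0 - 1) (x + 1) = 1"
        by (rule void_above[OF v]) (use n in auto)
      then show ?thesis
        using not_Lambda_nbhd_far[OF b(1), of "t0 - 1" x] not_Lambda_nbhd_far[OF b(1), of "t0 - 1" "x + 1"]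
          \<open>r \<ge> 2\<close> 3 by (auto simp: s)
    next
      case (Suc m)
      then show ?thesis using n x 3 unfolding void_triangle_def
        by (intro CollectI exI[of _ y] exI[of _ m]) auto
    qed
  qed
qed

text \<open>A finite component must start inside the cone, hence in the triangle of some void, which
  no path avoiding the neighbourhood can leave.\<close>

lemma bounded_component_in_void:
  assumes K: "K \<in> lattice_components (- \<Lambda>_nbhd r)" "finite K" and "r \<ge> 2"
  shows "K \<subseteq> - \<Lambda>_nbhd r \<and> (\<exists>t p q. void t p q \<and> K \<subseteq> void_triangle t p q)"
proof -
  obtain x t where xt: "(x, t) \<notin> \<Lambda>_nbhd r" and Kd: "K = lattice_component (- \<Lambda>_nbhd r) (x, t)"
    using K(1) by (auto simp: lattice_components_def)
  have "\<bar>x\<bar> \<le> t" using outside_cone_infinite[OF xt] K(2) Kd by force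
  moreover have "pulse (nat t) x = 0"
    by (rule not_Lambda_nbhd[OF xt]) (use \<open>r \<ge> 2\<close> \<open>\<bar>x\<bar> \<le> t\<close> in auto)
  moreover have "\<bar>x\<bar> \<le> int (nat t)" using \<open>\<bar>x\<bar> \<le> t\<close> by linarith
  ultimately obtain t0 p q n
    where v: "void t0 p q" and n: "nat t = t0 + n" "p + int n \<le> x" "x \<le> q - int n"
    using void_around[of "nat t" x] by blast
  have start: "(x, t) \<in> void_triangle t0 p q"
    using n \<open>\<bar>x\<bar> \<le> t\<close> unfolding void_triangle_def by (intro CollectI exI[of _ x] exI[of _ n]) auto
  have "z \<notin> \<Lambda>_nbhd r \<and> z \<in> void_triangle t0 p q" if "z \<in> K" for z
  proof -
    from that have "((x, t), z) \<in> {(u, v). u \<in> - \<Lambda>_nbhd r \<and> v \<in> - \<Lambda>_nbhd r \<and> l1_dist u v = 1}\<^sup>*"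
      by (simp add: Kd lattice_component_def)
    then show ?thesis
    proof (induction rule: rtrancl_induct)
      case base
      then show ?case using xt start by simp
    next
      case (step y z)
      obtain a b c d where "y = (a, b)" "z = (c, d)" by (cases y; cases z)
      with step show ?case
        using void_triangle_step[OF v \<open>r \<ge> 2\<close>, of a b c d] by (auto simp: l1_dist_def)
    qed
  qed
  then show ?thesis using v by blast
qed

text \<open>Distance \<open>r\<close> from the sides provides the margins \<open>2 ^ k\<close> and
  \<open>L\<close> of \<open>void_states\<close> and the width \<open>6 * 2 ^ k\<close>; distance
  from the row above the void provides the \<open>j\<close> steps until the ether sets in.\<close>

lemma replicator_if_determined:
  assumes f: "web_CA f" "empty_compliant f"
    and seed: "\<And>x. x \<notin> {0..int L} \<Longrightarrow> bit_of (\<xi> x) = 0"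
    and det: "determined f (2 ^ k) (web_row k L \<xi>)"
    and \<eta>: "ether \<eta>" "\<And>t x. t \<ge> j \<Longrightarrow> \<eta> (x, int t) = evolve f (state_row (web_row k L \<xi>)) t x"
    and r: "r \<ge> real (4 * 2 ^ k + j + 4 + L)"
  shows "replicator (evolve f \<xi>) r \<eta>"
  unfolding replicator_def
proof (intro ballI impI)
  fix K assume K: "K \<in> lattice_components (- \<Lambda>_nbhd r)" "finite K"
  define N :: nat where "N = 2 ^ k"
  have iN: "(2 ^ k :: int) = int N" by (simp add: N_def)
  have r': "r \<ge> 4 * real N + real j + 4 + real L" using r by (simp add: N_def)
  obtain t0 p q where off: "K \<subseteq> - \<Lambda>_nbhd r" and v: "void t0 p q" and tri: "K \<subseteq> void_triangle t0 p q"
    using bounded_component_in_void[OF K] r' by auto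
  have "K \<noteq> {}" using K(1) by (auto simp: lattice_components_def lattice_component_def)
  have deep: "\<exists>n. t = int (t0 + n) \<and> n \<ge> j \<and> p + int N + int L + int n \<le> x \<and> x \<le> q - int N - int n \<and>
      q - p \<ge> 6 * int N" if "(x, t) \<in> K" for x t
  proof -
    from that tri obtain n where n: "t = int (t0 + n)" "p + int n \<le> x" "x \<le> q - int n"
      by (auto simp: void_triangle_def)
    have xt: "(x, t) \<notin> \<Lambda>_nbhd r" using that off by auto
    have bd: "pulse (t0 + n) (p + int n - 1) = 1" "pulse (t0 + n) (q - int n + 1) = 1"
      using void_triangle_boundary[OF v, of n] n by auto
    have 1: "r < real_of_int (x - (p + int n - 1))"
      using not_Lambda_nbhd_far[OF xt bd(1)] n by simp
    have 2: "r < real_of_int (q - int n + 1 - x)"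
      using not_Lambda_nbhd_far[OF xt bd(2)] n by simp
    have "t0 \<ge> 1" using v by (simp add: void_def)
    have "pulse (t0 - 1) x = 1 \<or> pulse (t0 - 1) (x + 1) = 1"
      by (rule void_above[OF v]) (use n in auto)
    then have 3: "r < real n + 2"
      using not_Lambda_nbhd_far[OF xt, of "t0 - 1" x] not_Lambda_nbhd_far[OF xt, of "t0 - 1" "x + 1"]
        n \<open>t0 \<ge> 1\<close> by (auto simp: of_nat_diff)
    have "n \<ge> j" using 3 r' by linarith
    moreover have "p + int N + int L + int n \<le> x" using 1 r' by linarith
    moreover have "x \<le> q - int N - int n" using 2 r' by linarith
    moreover have "q - p \<ge> 6 * int N" using 1 2 r' by linarith
    ultimately show ?thesis using n(1) by blast
  qed
  have "q - p \<ge> 6 * 2 ^ k" using \<open>K \<noteq> {}\<close> deep unfolding iN by fastforce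
  then obtain a where a: "\<And>n x. p + int N + int L + int n \<le> x \<Longrightarrow> x \<le> q - int N - int n \<Longrightarrow>
      evolve f \<xi> (t0 + n) x = evolve f (state_row (web_row k L \<xi>)) (N + n) (x - a)"
    using void_states[OF f seed det v] unfolding iN N_def[symmetric] by blast
  \<comment> \<open>Time is recounted from the periodic row \<open>N\<close> steps above the top
    \<open>t0\<close>, and space from its offset \<open>a\<close>.\<close>
  define \<eta>' where "\<eta>' = (\<lambda>(x, t). \<eta> (x + (- a), t + (int N - int t0)))"
  have "ether \<eta>'"
  proof -
    obtain m n where m: "m > 0" "\<And>x t. \<eta> (x + m, t) = \<eta> (x, t)" and n: "n > 0" "\<And>x t. \<eta> (x, t + n) = \<eta> (x, t)"
      using \<eta>(1) unfolding ether_def by blast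
    have "\<eta>' (x + m, t) = \<eta>' (x, t)" "\<eta>' (x, t + n) = \<eta>' (x, t)" for x t
      using m(2)[of "x - a" "t + (int N - int t0)"] n(2)[of "x - a" "t + (int N - int t0)"]
      by (simp_all add: \<eta>'_def algebra_simps)
    moreover have "\<eta>' z \<in> {S0, S2}" for z
      using \<eta>(1) unfolding ether_def \<eta>'_def by (cases z) (simp only: prod.case)
    ultimately show ?thesis using m(1) n(1) unfolding ether_def by blast
  qed
  moreover have "ether_equiv \<eta> \<eta>'"
    unfolding ether_equiv_def \<eta>'_def by (intro exI[of _ "- a"] exI[of _ "int N - int t0"]) simp
  moreover have "evolve f \<xi> (nat t) x = \<eta>' (x, t) \<and> t \<ge> 0" if "(x, t) \<in> K" for x t
  proof -
    from deep[OF that] obtain n where n: "t = int (t0 + n)" "n \<ge> j"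
        "p + int N + int L + int n \<le> x" "x \<le> q - int N - int n"
      by blast
    have "evolve f \<xi> (nat t) x = evolve f (state_row (web_row k L \<xi>)) (N + n) (x - a)"
      using a[OF n(3,4)] by (simp only: n(1) nat_int)
    also have "\<dots> = \<eta> (x - a, int (N + n))" using \<eta>(2)[of "N + n"] n(2) by simp
    also have "\<dots> = \<eta>' (x, t)" by (simp add: \<eta>'_def n(1) algebra_simps)
    finally show ?thesis using n(1) by simp
  qed
  ultimately show "filled (evolve f \<xi>) \<eta> K" unfolding filled_def by fast
qed

section \<open>Random seeds\<close>

text \<open>At level \<open>Suc k\<close> there are \<open>2 ^ k\<close> pairs of steps, each
  keeping at most 14 of 16, which gives the powers of 7/8.\<close>

lemma prob_undetermined:
  assumes f: "web_CA f" "diagonal_compliant f \<or> wide_compliant f" and L: "2 * 2 ^ Suc k \<le> int L + 1"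
  shows "measure_pmf.prob (random_seed L) {\<xi>. \<not> determined f (2 ^ Suc k) (web_row (Suc k) L \<xi>)} \<le>
    6 * (real (2 ^ k) * (7 / 8) ^ (2 ^ k))"
proof -
  let ?B = "{w\<in>sol (2 ^ Suc k). \<not> determined f (2 ^ Suc k) w}"
  have "{\<xi>. \<not> determined f (2 ^ Suc k) (web_row (Suc k) L \<xi>)} = {\<xi>. web_row (Suc k) L \<xi> \<in> ?B}"
    using fold_seed_in_sol[of "Suc k" L] by (simp add: web_row_def del: power_Suc)
  then have "measure_pmf.prob (random_seed L) {\<xi>. \<not> determined f (2 ^ Suc k) (web_row (Suc k) L \<xi>)} =
      card ?B / 4 ^ (2 ^ Suc k)"
    using prob_web_row[OF L, of ?B] by (simp del: power_Suc)
  also have "\<dots> \<le> (14 ^ (2 ^ k) * (6 * 2 ^ k)) / 4 ^ (2 ^ Suc k)"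
  proof (rule divide_right_mono)
    have "card ?B \<le> 14 ^ (2 ^ k) * (6 * 2 ^ k)"
      using card_undetermined[OF f, of "Suc k"] by simp
    then have "real (card ?B) \<le> real (14 ^ (2 ^ k) * (6 * 2 ^ k))" by (simp only: of_nat_le_iff)
    then show "real (card ?B) \<le> 14 ^ (2 ^ k) * (6 * 2 ^ k)" by simp
  qed simp
  also have "(4 :: real) ^ (2 ^ Suc k) = 16 ^ (2 ^ k)" by (simp add: power_mult)
  also have "14 ^ (2 ^ k) * (6 * 2 ^ k) / 16 ^ (2 ^ k) = 6 * (real (2 ^ k) * (14 / 16) ^ (2 ^ k))"
    by (simp only: power_divide) simp
  finally show ?thesis by simp
qed

lemma undetermined_bound_tendsto_0: "(\<lambda>k. 6 * (real (2 ^ k) * (7 / 8) ^ (2 ^ k))) \<longlonglongrightarrow> 0"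
proof -
  have "(\<lambda>n. real n * (7 / 8) ^ n) \<longlonglongrightarrow> 0"
    using powser_times_n_limit_0[of "7 / 8 :: real"] by simp
  then have "((\<lambda>n. real n * (7 / 8) ^ n) \<circ> (\<lambda>k. 2 ^ k)) \<longlonglongrightarrow> 0"
    by (rule LIMSEQ_subseq_LIMSEQ) (simp add: strict_mono_def)
  then show ?thesis by (intro tendsto_mult_right_zero) (simp add: o_def)
qed

section \<open>The level at which a seed is determined\<close>

definition settled :: "rule \<Rightarrow> nat \<Rightarrow> (int \<Rightarrow> state) \<Rightarrow> bool" where
  "settled f L \<xi> \<longleftrightarrow> (\<exists>k. determined f (2 ^ k) (web_row k L \<xi>))"

definition level :: "rule \<Rightarrow> nat \<Rightarrow> (int \<Rightarrow> state) \<Rightarrow> nat" where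
  "level f L \<xi> = (LEAST k. determined f (2 ^ k) (web_row k L \<xi>))"

lemma determined_level: "settled f L \<xi> \<Longrightarrow> determined f (2 ^ level f L \<xi>) (web_row (level f L \<xi>) L \<xi>)"
  unfolding settled_def level_def by (rule LeastI_ex)

lemma level_le: "determined f (2 ^ k) (web_row k L \<xi>) \<Longrightarrow> level f L \<xi> \<le> k"
  unfolding level_def by (rule Least_le)

lemma web_row_in_sol: "web_row k L \<xi> \<in> sol (2 ^ k)"
  unfolding web_row_def by (rule fold_seed_in_sol)

text \<open>The row at the level fixes all rows of lower level, hence also which of them are
  determined, so that the least level agrees even for seeds on different intervals.\<close>

lemma level_cong:
  assumes s: "settled f L \<xi>" and eq: "web_row (level f L \<xi>) L' \<xi>' = web_row (level f L \<xi>) L \<xi>"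
  shows "settled f L' \<xi>'" "level f L' \<xi>' = level f L \<xi>"
proof -
  let ?k = "level f L \<xi>"
  have down: "web_row j L' \<xi>' = web_row j L \<xi>" if "j \<le> ?k" for j
    using eq one3_fold_seed_diff[OF that] unfolding web_row_def by metis
  have det: "determined f (2 ^ ?k) (web_row ?k L' \<xi>')" using determined_level[OF s] eq by simp
  then show s': "settled f L' \<xi>'" unfolding settled_def by blast
  have le: "level f L' \<xi>' \<le> ?k" by (rule level_le[OF det])
  have "?k \<le> level f L' \<xi>'"
    by (rule level_le) (use determined_level[OF s'] down[OF le] in simp)
  with le show "level f L' \<xi>' = ?k" by simp
qed

lemma ether_const: "ether (\<lambda>_. S0)"
  unfolding ether_def by (auto intro: exI[of _ 1])

lemma evolve_no_S2:
  assumes "\<not> spontaneous_birth f" "\<And>x. \<xi> x \<noteq> S2"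
  shows "evolve f \<xi> t x \<noteq> S2"
proof (induction t arbitrary: x)
  case (Suc t)
  then have "evolve f (evolve f \<xi> t) 1 x \<noteq> S2"
    using assms(1) unfolding spontaneous_birth_def by blast
  then show ?case by (simp flip: evolve_add)
qed (use assms in simp)

text \<open>Periodicity in time carries every point to a time of at least \<open>j\<close>.\<close>

lemma ether_eq_S0:
  assumes "ether \<eta>" "\<And>t x. t \<ge> j \<Longrightarrow> \<eta> (x, int t) \<noteq> S2"
  shows "\<eta> = (\<lambda>_. S0)"
proof
  fix p :: "int \<times> int"
  obtain x t where p: "p = (x, t)" by (cases p)
  obtain n where n: "n > 0" "\<And>x t. \<eta> (x, t + n) = \<eta> (x, t)" using assms(1) unfolding ether_def by blast
  have per: "\<eta> (x, t + int m * n) = \<eta> (x, t)" for m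
  proof (induction m)
    case (Suc m)
    then show ?case using n(2)[of x "t + int m * n"] by (simp add: algebra_simps)
  qed simp
  define m where "m = nat \<bar>t\<bar> + j"
  have "int m * 1 \<le> int m * n" using n(1) by (intro mult_left_mono) auto
  then have "t + int m * n \<ge> int j" by (simp add: m_def)
  then have "\<eta> (x, int (nat (t + int m * n))) \<noteq> S2" by (intro assms(2)) auto
  then have "\<eta> (x, t) \<noteq> S2" using \<open>t + int m * n \<ge> int j\<close> per[of m] by simp
  moreover have "\<eta> (x, t) \<in> {S0, S2}" using assms(1) unfolding ether_def by blast
  ultimately show "\<eta> p = S0" by (simp add: p)
qed

theorem theorem1p2:
  fixes f :: rule
  assumes "web_CA f"
    and "diagonal_compliant f \<or> wide_compliant f"
  shows "\<exists>(R :: nat \<Rightarrow> (int \<Rightarrow> state) \<Rightarrow> ennreal)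
          (\<eta> :: nat \<Rightarrow> (int \<Rightarrow> state) \<Rightarrow> int \<times> int \<Rightarrow> state).
      (\<forall>L. \<forall>\<xi>0 \<in> binary_seeds_on L. ether (\<eta> L \<xi>0)) \<and>
      (\<lambda>L. measure_pmf.prob (random_seed L) {\<xi>0. R L \<xi>0 = \<infinity>}) \<longlonglongrightarrow> 0 \<and>
      ((\<lambda>\<rho>::real. limsup (\<lambda>L. ereal (measure_pmf.prob (random_seed L) {\<xi>0. R L \<xi>0 > ennreal \<rho>})))
         \<longlongrightarrow> 0) at_top \<and>
      (\<forall>L. \<forall>\<xi>0 \<in> binary_seeds_on L. R L \<xi>0 < \<infinity> \<longrightarrow>
         replicator (evolve f \<xi>0) (enn2real (R L \<xi>0) + real L) (\<eta> L \<xi>0)) \<and>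
      (\<forall>L. \<forall>\<xi>0 \<in> binary_seeds_on L. \<forall>A. finite A \<and> A \<subseteq> {x. \<xi>0 x = S0} \<and> R L \<xi>0 < \<infinity> \<longrightarrow>
         replicator (evolve f (change_to_2 A \<xi>0)) (enn2real (R L \<xi>0) + real L) (\<eta> L \<xi>0)) \<and>
      (\<not> spontaneous_birth f \<longrightarrow>
         (\<forall>L. \<forall>\<xi>0 \<in> binary_seeds_on L. R L \<xi>0 < \<infinity> \<longrightarrow> \<eta> L \<xi>0 = (\<lambda>_. S0))) \<and>
      (spontaneous_birth f \<longrightarrow>
         (\<forall>\<eta>0. ether \<eta>0 \<longrightarrow>
            (\<exists>L. \<exists>\<xi>0 \<in> binary_seeds_on L. R L \<xi>0 < \<infinity> \<and> \<eta> L \<xi>0 = \<eta>0) \<longrightarrow>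
            liminf (\<lambda>L. ereal (measure_pmf.prob (random_seed L)
              {\<xi>0. R L \<xi>0 < \<infinity> \<and> \<eta> L \<xi>0 = \<eta>0})) > 0))"
proof -
  have empty: "empty_compliant f"
    using assms(2) unfolding wide_compliant_def diagonal_compliant_def empty_compliant_def by metis
  define good where "good k w \<eta> j \<longleftrightarrow> ether \<eta> \<and> (\<forall>t\<ge>j. \<forall>x. \<eta> (x, int t) = evolve f (state_row w) t x)"
    for k :: nat and w \<eta> and j :: nat
  \<comment> \<open>The ether is chosen as a function of level and row alone, so seeds with the same
    row get the same ether, not just an equivalent one, as (ii) demands.\<close>
  define E where "E k w = (SOME \<eta>. \<exists>j. good k w \<eta> j)" for k w
  define J where "J k w = (SOME j. good k w (E k w) j)" for k w
  have EJ: "ether (E k w) \<and> (\<forall>t\<ge>J k w. \<forall>x. E k w (x, int t) = evolve f (state_row w) t x)"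
    if "w \<in> sol (2 ^ k)" for k w
  proof -
    have "\<exists>\<eta> j. good k w \<eta> j" using eventually_ether[OF assms(1) that] by (simp add: good_def)
    then have "\<exists>j. good k w (E k w) j" unfolding E_def by (rule someI_ex)
    then have "good k w (E k w) (J k w)" unfolding J_def by (rule someI_ex)
    then show ?thesis unfolding good_def .
  qed
  \<comment> \<open>The bound of \<open>replicator_if_determined\<close> without \<open>L\<close>,
    which the statement adds separately; this is what makes tightness possible.\<close>
  define thick where "thick k w = 4 * 2 ^ k + J k w + 4" for k :: nat and w
  define R where "R L \<xi> = (if settled f L \<xi>
      then ennreal (real (thick (level f L \<xi>) (web_row (level f L \<xi>) L \<xi>))) else \<infinity>)" for L \<xi>
  define \<eta> where "\<eta> L \<xi> = (if settled f L \<xi> then E (level f L \<xi>) (web_row (level f L \<xi>) L \<xi>)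
      else (\<lambda>_. S0))" for L \<xi>
  define bd where "bd k = 6 * (real (2 ^ k) * (7 / 8) ^ (2 ^ k))" for k :: nat
  have R_fin: "R L \<xi> < \<infinity> \<longleftrightarrow> settled f L \<xi>" for L \<xi> by (simp add: R_def)
  have small: "\<exists>k. bd k < e" if "e > 0" for e
    using order_tendstoD(2)[OF undetermined_bound_tendsto_0 that]
    unfolding bd_def eventually_sequentially by blast
  have prob: "eventually (\<lambda>L. measure_pmf.prob (random_seed L)
      {\<xi>. \<not> determined f (2 ^ Suc k) (web_row (Suc k) L \<xi>)} \<le> bd k) sequentially" for k
    unfolding eventually_sequentially bd_def
  proof (intro exI allI impI prob_undetermined[OF assms])
    fix L :: nat assume "2 * 2 ^ Suc k \<le> L"
    then have "int (2 * 2 ^ Suc k) \<le> int L" by (simp only: of_nat_le_iff)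
    then show "2 * 2 ^ Suc k \<le> int L + 1" by simp
  qed

  have "ether (\<eta> L \<xi>)" for L \<xi>
    unfolding \<eta>_def using EJ[OF web_row_in_sol] ether_const by simp

  moreover have "(\<lambda>L. measure_pmf.prob (random_seed L) {\<xi>. R L \<xi> = \<infinity>}) \<longlonglongrightarrow> 0"
  proof (rule order_tendstoI)
    fix e :: real assume "0 < e"
    then obtain k where k: "bd k < e" using small by blast
    show "eventually (\<lambda>L. measure_pmf.prob (random_seed L) {\<xi>. R L \<xi> = \<infinity>} < e) sequentially"
      using prob[of k]
    proof eventually_elim
      case (elim L)
      have "measure_pmf.prob (random_seed L) {\<xi>. R L \<xi> = \<infinity>} \<le>
          measure_pmf.prob (random_seed L) {\<xi>. \<not> determined f (2 ^ Suc k) (web_row (Suc k) L \<xi>)}"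
        by (rule measure_pmf.finite_measure_mono) (auto simp: R_def settled_def simp del: power_Suc split: if_splits)
      with elim k show ?case by linarith
    qed
  next
    fix e :: real assume "e < 0"
    then show "eventually (\<lambda>L. e < measure_pmf.prob (random_seed L) {\<xi>. R L \<xi> = \<infinity>}) sequentially"
      by (intro always_eventually allI) (rule less_le_trans[OF _ measure_nonneg])
  qed

  moreover have "((\<lambda>\<rho>::real. limsup (\<lambda>L. ereal (measure_pmf.prob (random_seed L) {\<xi>. R L \<xi> > ennreal \<rho>})))
      \<longlongrightarrow> 0) at_top"
  proof (rule order_tendstoI)
    fix e :: ereal assume "0 < e"
    then obtain e' :: real where e': "0 < ereal e'" "ereal e' < e" using ereal_dense2 by blast
    then obtain k where k: "bd k < e'" using small[of e'] by auto
    \<comment> \<open>There are finitely many rows up to level \<open>Suc k\<close>, so the sum of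
      their thicknesses bounds \<open>R\<close> for every seed determined by then, whatever
      \<open>L\<close> is.\<close>
    define M where "M = (\<Sum>j\<le>Suc k. \<Sum>w\<in>sol (2 ^ j). thick j w)"
    have M: "R L \<xi> \<le> ennreal (real M)" if det: "determined f (2 ^ Suc k) (web_row (Suc k) L \<xi>)" for L \<xi>
    proof -
      let ?j = "level f L \<xi>"
      have s: "settled f L \<xi>" using det unfolding settled_def by blast
      have "thick ?j (web_row ?j L \<xi>) \<le> (\<Sum>w\<in>sol (2 ^ ?j). thick ?j w)"
        by (rule member_le_sum) (simp_all add: web_row_in_sol)
      also have "\<dots> \<le> M"
        unfolding M_def by (rule member_le_sum) (use level_le[OF det] in auto)
      finally show ?thesis using s by (simp add: R_def ennreal_leI)
    qed
    show "eventually (\<lambda>\<rho>. limsup (\<lambda>L. ereal (measure_pmf.prob (random_seed L) {\<xi>. R L \<xi> > ennreal \<rho>})) < e) at_top"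
      using eventually_ge_at_top[of "real M"]
    proof eventually_elim
      case (elim \<rho>)
      have "limsup (\<lambda>L. ereal (measure_pmf.prob (random_seed L) {\<xi>. R L \<xi> > ennreal \<rho>})) \<le> ereal (bd k)"
      proof (rule Limsup_bounded)
        show "eventually (\<lambda>L. ereal (measure_pmf.prob (random_seed L) {\<xi>. R L \<xi> > ennreal \<rho>}) \<le> ereal (bd k)) sequentially"
          using prob[of k]
        proof eventually_elim
          case (elim L)
          have "measure_pmf.prob (random_seed L) {\<xi>. R L \<xi> > ennreal \<rho>} \<le>
              measure_pmf.prob (random_seed L) {\<xi>. \<not> determined f (2 ^ Suc k) (web_row (Suc k) L \<xi>)}"
          proof (rule measure_pmf.finite_measure_mono)
            have "\<not> R L \<xi> > ennreal \<rho>" if "determined f (2 ^ Suc k) (web_row (Suc k) L \<xi>)" for \<xi>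
              using M[OF that] ennreal_leI[OF \<open>real M \<le> \<rho>\<close>] by (meson leD order_trans)
            then show "{\<xi>. R L \<xi> > ennreal \<rho>} \<subseteq> {\<xi>. \<not> determined f (2 ^ Suc k) (web_row (Suc k) L \<xi>)}"
              by blast
          qed simp
          with elim show ?case by simp
        qed
      qed
      also have "\<dots> < e" using k e' by (meson ereal_less_eq(3) le_less_trans less_imp_le)
      finally show ?case .
    qed
  next
    fix e :: ereal assume "e < 0"
    moreover have "0 \<le> limsup (\<lambda>L. ereal (measure_pmf.prob (random_seed L) {\<xi>. R L \<xi> > ennreal \<rho>}))" for \<rho>
      by (rule le_Limsup) auto
    ultimately show "eventually (\<lambda>\<rho>. e < limsup (\<lambda>L. ereal (measure_pmf.prob (random_seed L) {\<xi>. R L \<xi> > ennreal \<rho>}))) at_top"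
      by (intro always_eventually allI) (rule less_le_trans)
  qed

  \<comment> \<open>Only the web of the initial row is compared with the seed, so this covers the
    seed itself and every change of 0s into 2s.\<close>
  moreover have rep: "replicator (evolve f \<xi>') (enn2real (R L \<xi>) + real L) (\<eta> L \<xi>)"
    if \<xi>: "\<xi> \<in> binary_seeds_on L" and fin: "R L \<xi> < \<infinity>" and bits: "\<And>x. bit_of (\<xi>' x) = bit_of (\<xi> x)"
    for L \<xi> \<xi>'
  proof -
    let ?k = "level f L \<xi>"
    have s: "settled f L \<xi>" using fin unfolding R_fin .
    have row: "web_row k L \<xi>' = web_row k L \<xi>" for k by (simp add: web_row_def bits)
    show ?thesis
    proof (rule replicator_if_determined[OF assms(1) empty, where k = ?k and j = "J ?k (web_row ?k L \<xi>)"])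
      show "bit_of (\<xi>' x) = 0" if "x \<notin> {0..int L}" for x
        using \<xi> that by (simp add: bits binary_seeds_on_def)
      show "determined f (2 ^ ?k) (web_row ?k L \<xi>')" unfolding row by (rule determined_level[OF s])
      show "ether (\<eta> L \<xi>)"
        "\<And>t x. t \<ge> J ?k (web_row ?k L \<xi>) \<Longrightarrow> \<eta> L \<xi> (x, int t) = evolve f (state_row (web_row ?k L \<xi>')) t x"
        using EJ[OF web_row_in_sol] s by (simp_all add: \<eta>_def row)
      show "real (4 * 2 ^ ?k + J ?k (web_row ?k L \<xi>) + 4 + L) \<le> enn2real (R L \<xi>) + real L"
      proof -
        have "enn2real (R L \<xi>) = real (thick ?k (web_row ?k L \<xi>))"
          unfolding R_def if_P[OF s] by (rule enn2real_ennreal) simp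
        then show ?thesis by (simp add: thick_def)
      qed
    qed
  qed

  moreover have "replicator (evolve f (change_to_2 A \<xi>)) (enn2real (R L \<xi>) + real L) (\<eta> L \<xi>)"
    if "\<xi> \<in> binary_seeds_on L" "A \<subseteq> {x. \<xi> x = S0}" "R L \<xi> < \<infinity>" for L \<xi> A
    by (rule rep[OF that(1,3)]) (use that(2) in \<open>auto simp: change_to_2_def\<close>)

  moreover have "\<eta> L \<xi> = (\<lambda>_. S0)" if nb: "\<not> spontaneous_birth f" for L \<xi>
  proof (cases "settled f L \<xi>")
    case True
    let ?k = "level f L \<xi>" let ?w = "web_row ?k L \<xi>"
    have "E ?k ?w = (\<lambda>_. S0)"
    proof (rule ether_eq_S0)
      show "ether (E ?k ?w)" using EJ[OF web_row_in_sol] by blast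
      fix t x assume "t \<ge> J ?k ?w"
      then have "E ?k ?w (x, int t) = evolve f (state_row ?w) t x" using EJ[OF web_row_in_sol] by blast
      also have "\<dots> \<noteq> S2" by (rule evolve_no_S2[OF nb]) (simp add: state_row_def)
      finally show "E ?k ?w (x, int t) \<noteq> S2" .
    qed
    then show ?thesis by (simp add: \<eta>_def True)
  qed (simp add: \<eta>_def)

  moreover have "liminf (\<lambda>L. ereal (measure_pmf.prob (random_seed L) {\<xi>. R L \<xi> < \<infinity> \<and> \<eta> L \<xi> = \<eta>0})) > 0"
    if fin: "R L0 \<xi>0 < \<infinity>" and \<eta>0: "\<eta> L0 \<xi>0 = \<eta>0" for L0 \<xi>0 \<eta>0
  proof -
    define k where "k = level f L0 \<xi>0"
    define w where "w = web_row k L0 \<xi>0"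
    have s: "settled f L0 \<xi>0" using fin unfolding R_fin .
    \<comment> \<open>The folded row is uniform on \<open>4 ^ (2 ^ k)\<close> solutions, and the row
      \<open>w\<close> alone already forces the level and the ether of the given seed.\<close>
    have "ereal (1 / 4 ^ (2 ^ k)) \<le>
        liminf (\<lambda>L. ereal (measure_pmf.prob (random_seed L) {\<xi>. R L \<xi> < \<infinity> \<and> \<eta> L \<xi> = \<eta>0}))"
    proof (rule Liminf_bounded, unfold eventually_sequentially, intro exI allI impI)
      fix L :: nat assume "2 * 2 ^ k \<le> L"
      then have "int (2 * 2 ^ k) \<le> int L" by (simp only: of_nat_le_iff)
      then have L: "2 * 2 ^ k \<le> int L + 1" by simp
      have "1 / 4 ^ (2 ^ k) = measure_pmf.prob (random_seed L) {\<xi>. web_row k L \<xi> \<in> {w}}"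
        by (subst prob_web_row[OF L]) (simp_all add: w_def web_row_in_sol)
      also have "\<dots> \<le> measure_pmf.prob (random_seed L) {\<xi>. R L \<xi> < \<infinity> \<and> \<eta> L \<xi> = \<eta>0}"
      proof (rule measure_pmf.finite_measure_mono)
        show "{\<xi>. web_row k L \<xi> \<in> {w}} \<subseteq> {\<xi>. R L \<xi> < \<infinity> \<and> \<eta> L \<xi> = \<eta>0}"
        proof
          fix \<xi> assume "\<xi> \<in> {\<xi>. web_row k L \<xi> \<in> {w}}"
          then have row: "web_row (level f L0 \<xi>0) L \<xi> = web_row (level f L0 \<xi>0) L0 \<xi>0"
            by (simp add: w_def k_def)
          have "settled f L \<xi>" "level f L \<xi> = level f L0 \<xi>0" by (rule level_cong[OF s row])+
          then show "\<xi> \<in> {\<xi>. R L \<xi> < \<infinity> \<and> \<eta> L \<xi> = \<eta>0}"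
            using s row \<eta>0 unfolding mem_Collect_eq R_fin by (simp add: \<eta>_def)
        qed
      qed simp
      finally show "ereal (1 / 4 ^ (2 ^ k)) \<le>
          ereal (measure_pmf.prob (random_seed L) {\<xi>. R L \<xi> < \<infinity> \<and> \<eta> L \<xi> = \<eta>0})" by simp
    qed
    then show ?thesis by (rule less_le_trans[rotated]) simp
  qed

  ultimately show ?thesis by (intro exI[of _ R] exI[of _ \<eta>] conjI) blast+
qed

end
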